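(* Let $\chi$ be a non-principal even primitive Dirichlet character modulo $q$, and let $a,x>0$ with $\frac{a^2 q x}{16 \pi^2}\notin \mathbb{Z}_{>0}$. Then \begin{align*} \sum_{n=1}^\infty d_{\chi}(n) K_0(a\sqrt{nx})= \frac{2}{a^2x} L(1,\chi)-\frac{\tau(\chi)}{8 }L (1,\bar{\chi}) + \frac{a^2q\, x}{32\pi^4} \tau( \chi ) \sum_{n=1}^\infty d_{\bar{\chi} }(n) \frac{\log \left(\frac{16\pi^2 n}{a^2q x} \right) }{n^2-\left(\frac{a^2qx}{16\pi^2 } \right)^2}. \end{align*}
   Context: $d_\chi(n)=\sum_{d\mid n}\chi(d)$. $\tau(\chi)=\sum_{h=1}^q\chi(h)e^{2\pi i h/q}$ is the Gauss sum, $L(s,\chi)$ the Dirichlet $L$-function, and $K_0$ the modified Bessel function of the second kind of order $0$. *)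

theory Defs
  imports "HOL-Analysis.Analysis" "HOL-Number_Theory.Cong"
begin

definition dirichlet_character :: "nat \<Rightarrow> (int \<Rightarrow> complex) \<Rightarrow> bool" where
  "dirichlet_character q chi \<longleftrightarrow> q > 0 \<and>
     (\<forall>m n. chi (m * n) = chi m * chi n) \<and>
     (\<forall>n. chi (n + int q) = chi n) \<and>
     (\<forall>n. chi n = 0 \<longleftrightarrow> \<not> coprime n (int q))"

definition principal_character :: "nat \<Rightarrow> (int \<Rightarrow> complex) \<Rightarrow> bool" where
  "principal_character q chi \<longleftrightarrow> (\<forall>n. coprime n (int q) \<longrightarrow> chi n = 1)"

definition primitive_character :: "nat \<Rightarrow> (int \<Rightarrow> complex) \<Rightarrow> bool" where
  "primitive_character q chi \<longleftrightarrow> dirichlet_character q chi \<and>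
     (\<forall>d. d dvd q \<and> d < q \<longrightarrow>
        \<not> (\<forall>n. coprime n (int q) \<and> [n = 1] (mod int d) \<longrightarrow> chi n = 1))"

definition even_character :: "(int \<Rightarrow> complex) \<Rightarrow> bool" where
  "even_character chi \<longleftrightarrow> chi (-1) = 1"

definition conj_character :: "(int \<Rightarrow> complex) \<Rightarrow> (int \<Rightarrow> complex)" where
  "conj_character chi = (\<lambda>n. cnj (chi n))"

definition d_chi :: "(int \<Rightarrow> complex) \<Rightarrow> nat \<Rightarrow> complex" where
  "d_chi chi n = (\<Sum>d | d dvd n. chi (int d))"

definition gauss_sum :: "nat \<Rightarrow> (int \<Rightarrow> complex) \<Rightarrow> complex" where
  "gauss_sum q chi = (\<Sum>h = 1..q. chi (int h) * exp (2 * pi * \<i> * of_nat h / of_nat q))"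

text \<open>L(1,chi) for a non-principal character, as the (convergent) Dirichlet series.\<close>
definition dirichlet_L_one :: "(int \<Rightarrow> complex) \<Rightarrow> complex" where
  "dirichlet_L_one chi = (\<Sum>n. chi (int (Suc n)) / of_nat (Suc n))"

definition bessel_K0 :: "real \<Rightarrow> real" where
  "bessel_K0 x = integral {0..} (\<lambda>t. exp (- x * cosh t))"

end

theory Submission
  imports Defs "HOL-Number_Theory.Residues" "HOL-Real_Asymp.Real_Asymp"
begin

text \<open>
  Put $r = a^2 x / 4$ and $\theta(w) = \sum_{d \ge 1} \chi(d) e^{-dw}$. Since
  $2 K_0(2\sqrt{rdm}) = \int_0^\infty e^{-dw - rm/w}\,dw/w$, twice the left-hand side is
  $\int_0^\infty \theta(w)\,(e^{r/w}-1)^{-1}\,dw/w$. Poisson summation of $e^{-w|d|}$ over residue classes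
  (that is, the partial fraction expansion of $1/(e^z-1)$) and the finite Fourier expansion of $\chi$ give
  $\theta(w)/w = \frac{\tau(\chi)}{2}\sum_n \bar\chi(n)\, \frac{4}{q(w^2+(2\pi n/q)^2)}$. Splitting
  $(e^{r/w}-1)^{-1} = w/r - 1/2 + \sum_k 2rw/(r^2+(2\pi k w)^2)$ produces the three terms on the
  right-hand side. The first two integrals are sums over the character that converge only conditionally;
  they are taken termwise by dominated convergence, Abel summation providing the majorant. The last one is
  absolutely convergent, and its terms integrate to logarithms.
\<close>

subsection \<open>Sums over residue classes\<close>

lemma periodic_int_cong:
  fixes f :: "int \<Rightarrow> 'a"
  assumes "\<And>n. f (n + q) = f n" and "[m = n] (mod q)"
  shows "f m = f n"
proof -
  interpret periodic_fun_simple f q by standard (rule assms)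
  obtain k where "n = m + q * k" using assms(2) by (auto simp: cong_iff_lin)
  then show ?thesis using plus_of_int[of m k] by (simp add: mult.commute)
qed

lemma sum_periodic_complete_residues:
  fixes f :: "int \<Rightarrow> 'a::comm_monoid_add"
  assumes periodic: "\<And>n. f (n + q) = f n" and "q > 0"
    and "finite A" "card A = nat q"
    and inj: "\<And>x y. x \<in> A \<Longrightarrow> y \<in> A \<Longrightarrow> [g x = g y] (mod q) \<Longrightarrow> x = y"
  shows "(\<Sum>h\<in>A. f (g h)) = (\<Sum>h\<in>{0..<q}. f h)"
proof -
  have "inj_on (\<lambda>h. g h mod q) A"
    using inj by (auto simp: inj_on_def cong_def)
  moreover have "(\<lambda>h. g h mod q) ` A = {0..<q}"
    using \<open>q > 0\<close> \<open>card A = nat q\<close> calculation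
    by (intro card_subset_eq) (auto simp: card_image)
  ultimately have "(\<Sum>h\<in>A. f (g h mod q)) = (\<Sum>h\<in>{0..<q}. f h)"
    by (intro sum.reindex_bij_betw) (simp add: bij_betw_def)
  moreover have "f (n mod q) = f n" for n
    by (rule periodic_int_cong[of f q, OF periodic]) simp
  ultimately show ?thesis by simp
qed

lemma sum_periodic_shift:
  fixes f :: "int \<Rightarrow> 'a::comm_monoid_add"
  assumes "\<And>n. f (n + q) = f n" and "q > 0"
  shows "(\<Sum>h\<in>{m..<m + q}. f h) = (\<Sum>h\<in>{0..<q}. f h)"
proof (rule sum_periodic_complete_residues[of f q _ "\<lambda>h. h", OF assms])
  fix x y assume xy: "x \<in> {m..<m + q}" "y \<in> {m..<m + q}" "[x = y] (mod q)"
  then have "[x - m = y - m] (mod q)" by (intro cong_diff) auto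
  then show "x = y" using xy by (auto simp: cong_def)
qed auto

lemma sum_periodic_coprime_mult:
  fixes f :: "int \<Rightarrow> 'a::comm_monoid_add"
  assumes "\<And>n. f (n + q) = f n" and "q > 0" and "coprime m q"
  shows "(\<Sum>h\<in>{0..<q}. f (m * h)) = (\<Sum>h\<in>{0..<q}. f h)"
proof (rule sum_periodic_complete_residues[of f q, OF assms(1,2)])
  fix x y assume xy: "x \<in> {0..<q}" "y \<in> {0..<q}" "[m * x = m * y] (mod q)"
  then have "[x = y] (mod q)" using assms(3) by (simp add: cong_mult_lcancel)
  then show "x = y" using xy by (simp add: cong_def)
qed auto

lemma norm_sum_periodic_le:
  fixes f :: "int \<Rightarrow> 'a::real_normed_vector"
  assumes periodic: "\<And>n. f (n + int q) = f n" and "q > 0"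
    and zero: "(\<Sum>h\<in>{0..<int q}. f h) = 0" and bound: "\<And>n. norm (f n) \<le> C"
  shows "norm (\<Sum>h\<in>{m..<m + int N}. f h) \<le> real q * C"
proof (induction N rule: less_induct)
  case (less N)
  show ?case
  proof (cases "N < q")
    case True
    have "C \<ge> 0" using norm_ge_zero bound by (rule order_trans)
    have "norm (\<Sum>h\<in>{m..<m + int N}. f h) \<le> real N * C"
      using sum_norm_bound[of "{m..<m + int N}" f C] bound by simp
    also have "\<dots> \<le> real q * C"
      using True \<open>C \<ge> 0\<close> by (intro mult_right_mono) auto
    finally show ?thesis .
  next
    case False
    define M where "M = N - q"
    have "{m..<m + int N} = {m..<m + int M} \<union> {m + int M..<m + int M + int q}"
      using False by (auto simp: M_def)
    then have "(\<Sum>h\<in>{m..<m + int N}. f h) = (\<Sum>h\<in>{m..<m + int M}. f h)"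
      using sum_periodic_shift[of f "int q" "m + int M"] periodic \<open>q > 0\<close> zero
      by (simp add: sum.union_disjoint)
    then show ?thesis using less.IH[of M] False \<open>q > 0\<close> by (simp add: M_def)
  qed
qed

definition additive_char :: "nat \<Rightarrow> int \<Rightarrow> complex" where
  "additive_char q k = cis (2 * pi * of_int k / of_nat q)"

lemma additive_char_0 [simp]: "additive_char q 0 = 1"
  by (simp add: additive_char_def)

lemma additive_char_add: "additive_char q (j + k) = additive_char q j * additive_char q k"
  by (simp add: additive_char_def cis_mult ring_distribs add_divide_distrib)

lemma additive_char_mult_of_nat: "additive_char q (k * int n) = additive_char q k ^ n"
  by (induction n) (simp_all add: additive_char_add ring_distribs)

lemma additive_char_eq_1_iff:
  assumes "q > 0"
  shows "additive_char q k = 1 \<longleftrightarrow> int q dvd k"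
proof -
  have "additive_char q k = 1 \<longleftrightarrow> (\<exists>n::int. 2 * pi * of_int k / of_nat q = of_int (2 * n) * pi)"
    unfolding additive_char_def cis_conv_exp exp_eq_1 by simp
  also have "\<dots> \<longleftrightarrow> (\<exists>n::int. real_of_int k = of_int (n * int q))"
    using assms by (simp add: field_simps)
  also have "\<dots> \<longleftrightarrow> int q dvd k"
    unfolding of_int_eq_iff by (auto simp: dvd_def mult.commute)
  finally show ?thesis .
qed

lemma additive_char_periodic: "q > 0 \<Longrightarrow> additive_char q (k + int q) = additive_char q k"
  by (simp add: additive_char_add additive_char_eq_1_iff)

lemma additive_char_cong:
  assumes "q > 0" "[j = k] (mod int q)"
  shows "additive_char q j = additive_char q k"
  using additive_char_periodic[OF assms(1)] assms(2) by (rule periodic_int_cong)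

lemma sum_additive_char:
  assumes "q > 0"
  shows "(\<Sum>n\<in>{0..<int q}. additive_char q (k * n)) = (if int q dvd k then of_nat q else 0)"
proof -
  have "(\<Sum>n\<in>{0..<int q}. additive_char q (k * n)) = (\<Sum>n\<in>int ` {0..<q}. additive_char q (k * n))"
    by (simp add: image_int_atLeastLessThan)
  also have "\<dots> = (\<Sum>n<q. additive_char q k ^ n)"
    by (simp add: sum.reindex additive_char_mult_of_nat atLeast0LessThan)
  also have "\<dots> = (if int q dvd k then of_nat q else 0)"
  proof (cases "int q dvd k")
    case True
    then show ?thesis using assms by (simp add: additive_char_eq_1_iff[THEN iffD2])
  next
    case False
    then have "additive_char q k \<noteq> 1" using assms additive_char_eq_1_iff by blast
    moreover have "additive_char q k ^ q = 1"
      using additive_char_eq_1_iff[OF assms, of "k * int q"] by (simp add: additive_char_mult_of_nat)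
    ultimately show ?thesis using False by (simp add: geometric_sum)
  qed
  finally show ?thesis .
qed

subsection \<open>Dirichlet characters and Gauss sums\<close>

locale dirichlet_char =
  fixes q :: nat and chi :: "int \<Rightarrow> complex"
  assumes character: "dirichlet_character q chi"
begin

lemma q_pos: "q > 0" and chi_mult: "chi (m * n) = chi m * chi n"
  and chi_periodic: "chi (n + int q) = chi n"
  and chi_eq_0_iff: "chi n = 0 \<longleftrightarrow> \<not> coprime n (int q)"
  using character by (auto simp: dirichlet_character_def)

lemma chi_cong: "[m = n] (mod int q) \<Longrightarrow> chi m = chi n"
  by (rule periodic_int_cong[of chi, OF chi_periodic])

lemma chi_1: "chi 1 = 1"
  using chi_mult[of 1 1] chi_eq_0_iff[of 1] by simp

lemma chi_power: "chi (n ^ k) = chi n ^ k"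
  by (induction k) (simp_all add: chi_1 chi_mult)

lemma norm_chi_eq_1:
  assumes "coprime n (int q)"
  shows "norm (chi n) = 1"
proof -
  define m where "m = nat (n mod int q)"
  have m: "int m = n mod int q" using q_pos by (simp add: m_def)
  have "coprime (int m) (int q)" unfolding m using assms q_pos by (simp add: coprime_mod_left_iff)
  then have "[m ^ totient q = 1] (mod q)" by (intro euler_theorem) simp
  then have "[int m ^ totient q = 1] (mod int q)"
    by (metis cong_int_iff of_nat_1 of_nat_power)
  then have "chi (int m) ^ totient q = 1" using chi_cong by (metis chi_power chi_1)
  moreover have "chi (int m) = chi n" unfolding m by (rule chi_cong) simp
  ultimately have "norm (chi n) ^ totient q = 1" by (metis norm_one norm_power)
  then show ?thesis
    using power_eq_imp_eq_base[of "norm (chi n)" "totient q" 1] q_pos by simp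
qed

lemma norm_chi_le_1: "norm (chi n) \<le> 1"
  using norm_chi_eq_1[of n] chi_eq_0_iff[of n] by (cases "coprime n (int q)") auto

lemma sum_chi_eq_0:
  assumes "\<not> principal_character q chi"
  shows "(\<Sum>h\<in>{0..<int q}. chi h) = 0"
proof -
  obtain m where m: "coprime m (int q)" "chi m \<noteq> 1"
    using assms unfolding principal_character_def by blast
  have "(\<Sum>h\<in>{0..<int q}. chi h) = (\<Sum>h\<in>{0..<int q}. chi (m * h))"
    using m q_pos chi_periodic by (intro sum_periodic_coprime_mult[symmetric]) auto
  also have "\<dots> = chi m * (\<Sum>h\<in>{0..<int q}. chi h)"
    by (simp add: chi_mult sum_distrib_left)
  finally show ?thesis using m(2) by (simp only: mult_cancel_right1 simp_thms)
qed

lemma norm_sum_chi_le: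
  assumes "\<not> principal_character q chi"
  shows "norm (\<Sum>n<N. chi (int (Suc n))) \<le> real q"
proof -
  have "(\<Sum>n<N. chi (int (Suc n))) = (\<Sum>h\<in>{1..<1 + int N}. chi h)"
    by (rule sum.reindex_bij_witness[of _ "\<lambda>h. nat (h - 1)" "\<lambda>n. int (Suc n)"]) auto
  also have "norm \<dots> \<le> real q * 1"
    using chi_periodic q_pos sum_chi_eq_0[OF assms] norm_chi_le_1 by (rule norm_sum_periodic_le)
  finally show ?thesis by simp
qed

lemma gauss_sum_eq: "gauss_sum q chi = (\<Sum>h\<in>{0..<int q}. chi h * additive_char q h)"
proof -
  have "gauss_sum q chi = (\<Sum>h\<in>{1..q}. chi (int h) * additive_char q (int h))"
    by (simp add: gauss_sum_def additive_char_def cis_conv_exp mult_ac)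
  also have "\<dots> = (\<Sum>h\<in>{1..<1 + int q}. chi h * additive_char q h)"
    by (rule sum.reindex_bij_witness[of _ nat int]) auto
  also have "\<dots> = (\<Sum>h\<in>{0..<int q}. chi h * additive_char q h)"
    using q_pos by (intro sum_periodic_shift) (simp_all add: chi_periodic additive_char_periodic)
  finally show ?thesis .
qed

lemma sum_chi_additive_char_coprime:
  assumes "coprime n (int q)"
  shows "(\<Sum>h\<in>{0..<int q}. chi h * additive_char q (h * n)) = cnj (chi n) * gauss_sum q chi"
proof -
  have "gauss_sum q chi = (\<Sum>h\<in>{0..<int q}. chi (n * h) * additive_char q (n * h))"
    unfolding gauss_sum_eq using q_pos assms
    by (intro sum_periodic_coprime_mult[of "\<lambda>h. chi h * additive_char q h", symmetric])
       (simp_all add: chi_periodic additive_char_periodic)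
  also have "\<dots> = chi n * (\<Sum>h\<in>{0..<int q}. chi h * additive_char q (h * n))"
    by (simp add: chi_mult sum_distrib_left mult_ac)
  finally show ?thesis
    using norm_chi_eq_1[OF assms] by (simp add: mult_ac flip: complex_norm_square)
qed

lemma dirichlet_char_conj: "dirichlet_char q (conj_character chi)"
  using character by (simp add: dirichlet_char_def dirichlet_character_def conj_character_def)

end

locale primitive_dirichlet_char = dirichlet_char +
  assumes primitive: "primitive_character q chi"
begin

lemma sum_chi_additive_char_not_coprime:
  assumes "\<not> coprime n (int q)"
  shows "(\<Sum>h\<in>{0..<int q}. chi h * additive_char q (h * n)) = 0" (is "?G = 0")
proof -
  define g where "g = nat (gcd n (int q))"
  have g: "int g = gcd n (int q)" by (simp add: g_def)
  then have "int g dvd int q" "int g dvd n" by simp_all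
  then obtain d n' where d: "q = g * d" and n': "n = int g * n'"
    by (metis dvdE of_nat_dvd_iff)
  have "g \<noteq> 1" "g \<noteq> 0" using g assms d q_pos by (auto simp: coprime_iff_gcd_eq_1)
  then have "d dvd q" "d < q" using d q_pos by auto
  then obtain m where m: "coprime m (int q)" "[m = 1] (mod int d)" "chi m \<noteq> 1"
    using primitive unfolding primitive_character_def by blast
  \<comment> \<open>Multiplication by $m$ fixes $h \mapsto e(hn/q)$, which depends only on $h$ modulo $d$,
    but not the character.\<close>
  have fixed: "additive_char q (m * h * n) = additive_char q (h * n)" for h
  proof (rule additive_char_cong[OF q_pos])
    have "int q dvd (m - 1) * (h * n)"
      using m(2) unfolding d n' cong_iff_dvd_diff by (auto simp: dvd_def)
    then show "[m * h * n = h * n] (mod int q)"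
      by (simp add: cong_iff_dvd_diff algebra_simps)
  qed
  have periodic: "additive_char q ((h + int q) * n) = additive_char q (h * n)" for h
    by (rule additive_char_cong[OF q_pos]) (simp add: cong_iff_dvd_diff algebra_simps)
  have "?G = (\<Sum>h\<in>{0..<int q}. chi (m * h) * additive_char q (m * h * n))"
    using m q_pos
    by (intro sum_periodic_coprime_mult[of "\<lambda>h. chi h * additive_char q (h * n)", symmetric])
       (simp_all add: chi_periodic periodic)
  also have "\<dots> = chi m * ?G"
    unfolding fixed chi_mult sum_distrib_left by (simp add: mult.assoc)
  finally show ?thesis using m(3) by (simp only: mult_cancel_right1 simp_thms)
qed

lemma sum_chi_additive_char:
  "(\<Sum>h\<in>{0..<int q}. chi h * additive_char q (h * n)) = cnj (chi n) * gauss_sum q chi"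
  using sum_chi_additive_char_coprime sum_chi_additive_char_not_coprime chi_eq_0_iff
  by (cases "coprime n (int q)") auto

lemma chi_finite_fourier:
  "chi d = gauss_sum q chi / of_nat q * (\<Sum>n\<in>{0..<int q}. cnj (chi n) * additive_char q (- d * n))"
proof -
  have "gauss_sum q chi * (\<Sum>n\<in>{0..<int q}. cnj (chi n) * additive_char q (- d * n)) =
      (\<Sum>n\<in>{0..<int q}. (\<Sum>h\<in>{0..<int q}. chi h * additive_char q (h * n)) * additive_char q (- d * n))"
    unfolding sum_chi_additive_char by (simp add: sum_distrib_left mult_ac)
  also have "\<dots> = (\<Sum>n\<in>{0..<int q}. \<Sum>h\<in>{0..<int q}. chi h * additive_char q ((h - d) * n))"
    unfolding sum_distrib_right
    by (intro sum.cong refl) (simp add: mult.assoc algebra_simps flip: additive_char_add)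
  also have "\<dots> = (\<Sum>h\<in>{0..<int q}. chi h * (\<Sum>n\<in>{0..<int q}. additive_char q ((h - d) * n)))"
    by (subst sum.swap) (simp add: sum_distrib_left)
  also have "\<dots> = (\<Sum>h\<in>{0..<int q}. if h = d mod int q then chi h * of_nat q else 0)"
  proof (intro sum.cong refl)
    fix h assume "h \<in> {0..<int q}"
    then have "int q dvd h - d \<longleftrightarrow> h = d mod int q"
      by (simp add: mod_eq_dvd_iff[symmetric])
    then show "chi h * (\<Sum>n\<in>{0..<int q}. additive_char q ((h - d) * n)) =
        (if h = d mod int q then chi h * of_nat q else 0)"
      by (simp add: sum_additive_char q_pos)
  qed
  also have "\<dots> = chi d * of_nat q"
    using q_pos chi_cong[of "d mod int q" d] by simp
  finally show ?thesis using q_pos by (simp add: field_simps)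
qed

end

locale even_primitive_dirichlet_char = primitive_dirichlet_char +
  assumes even: "even_character chi" and nonprincipal: "\<not> principal_character q chi"
begin

lemma chi_minus: "chi (- n) = chi n"
  using even chi_mult[of "-1" n] by (simp add: even_character_def)

lemma chi_0: "chi 0 = 0"
proof (rule ccontr)
  assume "chi 0 \<noteq> 0"
  then have "q = 1" using chi_eq_0_iff by simp
  then have "chi n = 1" for n using chi_cong[of n 1] chi_1 by simp
  then show False using nonprincipal by (simp add: principal_character_def)
qed

lemma chi_cos_expansion:
  "chi d = gauss_sum q chi / of_nat q *
     (\<Sum>n\<in>{0..<int q}. cnj (chi n) * of_real (cos (of_int d * (2 * pi * of_int n / of_nat q))))"
proof -
  have cos: "additive_char q (- d * n) + additive_char q (- (- d) * n) =
      2 * of_real (cos (of_int d * (2 * pi * of_int n / of_nat q)))" for n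
    by (simp add: additive_char_def complex_eq_iff mult_ac)
  have "2 * chi d = chi d + chi (- d)" by (simp add: chi_minus)
  also have "\<dots> = gauss_sum q chi / of_nat q *
      (\<Sum>n\<in>{0..<int q}. cnj (chi n) * (additive_char q (- d * n) + additive_char q (- (- d) * n)))"
    by (subst (1 2) chi_finite_fourier) (simp add: sum.distrib ring_distribs)
  also have "\<dots> = 2 * (gauss_sum q chi / of_nat q *
      (\<Sum>n\<in>{0..<int q}. cnj (chi n) * of_real (cos (of_int d * (2 * pi * of_int n / of_nat q)))))"
    unfolding cos by (simp add: sum_distrib_left mult_ac)
  finally show ?thesis by (simp only: mult_left_cancel[OF zero_neq_numeral[symmetric]])
qed

end

subsection \<open>Unordered sums\<close>

lemma has_sum_atLeast1_imp_sums:
  assumes "(f has_sum S) {1::nat..}"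
  shows "(\<lambda>n. f (Suc n)) sums S"
proof -
  have "((\<lambda>n. f (Suc n)) has_sum S) UNIV \<longleftrightarrow> (f has_sum S) {1..}"
    by (rule has_sum_reindex_bij_witness[of _ "\<lambda>n. n - 1" Suc]) auto
  then show ?thesis using assms by (simp add: has_sum_imp_sums)
qed

lemma has_sum_sum:
  fixes f :: "'i \<Rightarrow> 'a \<Rightarrow> 'b::topological_comm_monoid_add"
  assumes "\<And>i. i \<in> I \<Longrightarrow> (f i has_sum S i) A"
  shows "((\<lambda>x. \<Sum>i\<in>I. f i x) has_sum (\<Sum>i\<in>I. S i)) A"
  using assms by (induction I rule: infinite_finite_induct) (auto intro!: has_sum_add)

lemma nonneg_sums_imp_has_sum_int:
  fixes f :: "int \<Rightarrow> real"
  assumes nonneg: "\<And>k. f k \<ge> 0" and sums: "(\<lambda>n. f (int n) + f (- int (Suc n))) sums S"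
  shows "(f has_sum S) UNIV"
proof -
  have "summable (\<lambda>n. f (int n) + f (- int (Suc n)))"
    using sums by (rule sums_summable)
  then have "summable (\<lambda>n. f (int n))" "summable (\<lambda>n. f (- int (Suc n)))"
    by (rule summable_comparison_test'[where N = 0], use nonneg in simp)+
  then obtain A B where halves: "(\<lambda>n. f (int n)) sums A" "(\<lambda>n. f (- int (Suc n))) sums B"
    by (auto simp: summable_def)
  have "(f has_sum A) (range int)" "(f has_sum B) (range (\<lambda>n. - int (Suc n)))"
    using halves[THEN sums_nonneg_imp_has_sum] nonneg
    by (simp_all add: has_sum_reindex inj_on_def o_def)
  then have "(f has_sum (A + B)) (range int \<union> range (\<lambda>n. - int (Suc n)))"
    by (rule has_sum_Un_disjoint) auto
  also have "range int \<union> range (\<lambda>n. - int (Suc n)) = UNIV"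
  proof -
    have "k \<in> range int \<union> range (\<lambda>n. - int (Suc n))" for k
      by (cases k rule: int_cases) auto
    then show ?thesis by blast
  qed
  also have "A + B = S"
    using sums_add[OF halves] sums by (rule sums_unique2)
  finally show ?thesis .
qed

lemma has_sum_int_even:
  fixes f :: "int \<Rightarrow> 'a::{real_normed_field, banach}"
  assumes sum: "(f has_sum S) UNIV" and even: "\<And>k. f (- k) = f k"
  shows "((\<lambda>n. f (int n)) has_sum (S - f 0) / 2) {1..}"
proof -
  have "f summable_on int ` {1..}"
    using has_sum_imp_summable[OF sum] by (rule summable_on_subset_banach) simp
  then obtain T where T: "(f has_sum T) (int ` {1..})"
    by (auto simp: summable_on_def)
  then have T_nat: "((\<lambda>n. f (int n)) has_sum T) {1..}"
    by (simp add: has_sum_reindex o_def)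
  then have "(f has_sum T) ((\<lambda>n. - int n) ` {1..})"
    by (simp add: has_sum_reindex inj_on_def o_def even)
  with T have "(f has_sum (T + T)) (int ` {1..} \<union> (\<lambda>n. - int n) ` {1..})"
    by (rule has_sum_Un_disjoint) auto
  then have "(f has_sum (f 0 + (T + T))) (insert 0 (int ` {1..} \<union> (\<lambda>n. - int n) ` {1..}))"
    by (rule has_sum_insert[rotated]) auto
  also have "insert 0 (int ` {1..} \<union> (\<lambda>n. - int n) ` {1..}) = UNIV"
  proof -
    have "k \<in> insert 0 (int ` {1..} \<union> (\<lambda>n. - int n) ` {1..})" for k
      by (cases k rule: int_cases3) auto
    then show ?thesis by blast
  qed
  finally have "T = (S - f 0) / 2"
    using has_sum_unique[OF sum] by simp
  then show ?thesis using T_nat by (simp only:)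
qed

lemma has_sum_int_residues:
  fixes f :: "int \<Rightarrow> 'a::topological_comm_monoid_add"
  assumes "q > 0" and sum: "\<And>r. r \<in> {0..<q} \<Longrightarrow> ((\<lambda>k. f (r + q * k)) has_sum S r) UNIV"
  shows "(f has_sum (\<Sum>r\<in>{0..<q}. S r)) UNIV"
proof -
  have "(f has_sum (\<Sum>r\<in>{0..<q}. S r)) (\<Union>r\<in>{0..<q}. range (\<lambda>k. r + q * k))"
  proof (rule sum_has_sum)
    show "(f has_sum S r) (range (\<lambda>k. r + q * k))" if "r \<in> {0..<q}" for r
      using sum[OF that] \<open>q > 0\<close> by (simp add: has_sum_reindex inj_on_def o_def)
    fix r s assume rs: "r \<in> {0..<q}" "s \<in> {0..<q}" "r \<noteq> s"
    have "(t + q * k) mod q = t" if "t \<in> {0..<q}" for t k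
      using that by simp
    then show "range (\<lambda>k. r + q * k) \<inter> range (\<lambda>k. s + q * k) = {}"
      using rs by (auto dest: arg_cong[of _ _ "\<lambda>n. n mod q"])
  qed simp
  also have "(\<Union>r\<in>{0..<q}. range (\<lambda>k. r + q * k)) = UNIV"
  proof -
    have "n mod q + q * (n div q) = n" "n mod q \<in> {0..<q}" for n
      using \<open>q > 0\<close> by simp_all
    then show ?thesis by (metis (no_types, lifting) UN_iff UNIV_eq_I rangeI)
  qed
  finally show ?thesis .
qed

lemma nonneg_summable_on_Times:
  fixes f :: "'i \<Rightarrow> real" and g :: "'j \<Rightarrow> real"
  assumes f: "f summable_on A" "\<And>i. f i \<ge> 0" and g: "g summable_on B" "\<And>j. g j \<ge> 0"
  shows "(\<lambda>(i, j). f i * g j) summable_on A \<times> B"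
proof (rule summable_on_SigmaI)
  show "((\<lambda>j. case (i, j) of (i, j) \<Rightarrow> f i * g j) has_sum f i * infsum g B) B" for i
    using has_sum_cmult_right[OF has_sum_infsum[OF g(1)]] by simp
  show "(\<lambda>i. f i * infsum g B) summable_on A"
    using f(1) by (rule summable_on_cmult_left)
qed (use f(2) g(2) in simp)

lemma has_sum_Times:
  fixes f :: "'i \<Rightarrow> 'a::{real_normed_div_algebra, banach}" and g :: "'j \<Rightarrow> 'a"
  assumes f: "(\<lambda>i. norm (f i)) summable_on A" "(f has_sum S) A"
    and g: "(\<lambda>j. norm (g j)) summable_on B" "(g has_sum T) B"
  shows "((\<lambda>(i, j). f i * g j) has_sum S * T) (A \<times> B)"
proof (rule has_sum_SigmaI)
  show "((\<lambda>j. case (i, j) of (i, j) \<Rightarrow> f i * g j) has_sum f i * T) B" for i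
    using has_sum_cmult_right[OF g(2)] by simp
  show "((\<lambda>i. f i * T) has_sum S * T) A"
    by (rule has_sum_cmult_left[OF f(2)])
  show "(\<lambda>(i, j). f i * g j) summable_on A \<times> B"
  proof (rule Infinite_Sum.abs_summable_summable)
    show "(\<lambda>p. norm (case p of (i, j) \<Rightarrow> f i * g j)) summable_on A \<times> B"
      using nonneg_summable_on_Times[OF f(1) norm_ge_zero g(1) norm_ge_zero]
      by (simp add: case_prod_unfold norm_mult)
  qed
qed

lemma has_sum_Times_of_real:
  fixes u :: "'i \<Rightarrow> complex" and v :: "'j \<Rightarrow> real"
  assumes u: "(u has_sum S) A" and v: "(v has_sum T) B"
  shows "((\<lambda>(i, j). u i * of_real (v j)) has_sum S * of_real T) (A \<times> B)"
proof -
  note norm_summable = has_sum_imp_summable[THEN summable_on_iff_abs_summable_on_complex[THEN iffD1]]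
  have "((\<lambda>j. complex_of_real (v j)) has_sum of_real T) B"
    using v by (rule has_sum_of_real)
  then show ?thesis
    by (intro has_sum_Times norm_summable[OF u] u norm_summable)
qed

lemma has_sum_divisor_sum:
  fixes f g :: "nat \<Rightarrow> 'a::{topological_semigroup_mult, semiring_0, topological_comm_monoid_add, t3_space}"
  assumes "((\<lambda>(i, j). f i * g (i * j)) has_sum S) ({1..} \<times> {1..})"
  shows "((\<lambda>n. (\<Sum>d | d dvd n. f d) * g n) has_sum S) {1..}"
proof -
  have "((\<lambda>(n, d). f d * g n) has_sum S) (Sigma {1..} (\<lambda>n. {d. d dvd n})) \<longleftrightarrow>
      ((\<lambda>(i, j). f i * g (i * j)) has_sum S) ({1..} \<times> {1..})"
    by (rule has_sum_reindex_bij_witness[where i = "\<lambda>(i, j). (i * j, i)" and j = "\<lambda>(n, d). (d, n div d)"])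
       (auto simp: Suc_le_eq dvd_pos_nat div_greater_zero_iff dvd_imp_le)
  then have "((\<lambda>(n, d). f d * g n) has_sum S) (Sigma {1..} (\<lambda>n. {d. d dvd n}))"
    using assms by simp
  then show ?thesis
    by (rule has_sum_SigmaD) (auto simp: sum_distrib_right intro!: has_sum_finiteI)
qed

subsection \<open>Partial fractions of the exponential\<close>

lemma Digamma_reflection:
  fixes z :: complex
  assumes "z \<notin> \<int>"
  shows "Digamma (1 - z) - Digamma z = of_real pi * cot (of_real pi * z)"
proof -
  have "1 - z \<notin> \<int>" using assms by (metis Ints_1 Ints_diff add_diff_cancel_left' diff_diff_eq2)
  then have nonpos: "z \<notin> \<int>\<^sub>\<le>\<^sub>0" "1 - z \<notin> \<int>\<^sub>\<le>\<^sub>0"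
    using assms nonpos_Ints_subset_Ints by auto
  have sin: "sin (of_real pi * z) \<noteq> 0"
  proof
    assume "sin (of_real pi * z) = 0"
    then obtain n :: int where "of_real pi * z = of_real (of_int n * pi)"
      by (auto simp: sin_eq_0)
    then have "z = of_int n" by (simp add: field_simps)
    then show False using assms by simp
  qed
  have "((\<lambda>w. rGamma w * rGamma (1 - w)) has_field_derivative
      rGamma z * rGamma (1 - z) * (Digamma (1 - z) - Digamma z)) (at z)"
    using nonpos by (auto intro!: derivative_eq_intros simp: algebra_simps)
  moreover have "((\<lambda>w. sin (of_real pi * w) / of_real pi) has_field_derivative
      cos (of_real pi * z)) (at z)"
    by (auto intro!: derivative_eq_intros)
  moreover have "(\<lambda>w::complex. rGamma w * rGamma (1 - w)) = (\<lambda>w. sin (of_real pi * w) / of_real pi)"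
    by (rule ext) (rule rGamma_reflection_complex)
  ultimately have "rGamma z * rGamma (1 - z) * (Digamma (1 - z) - Digamma z) = cos (of_real pi * z)"
    using DERIV_unique by metis
  then show ?thesis
    using sin by (simp add: rGamma_reflection_complex cot_def field_simps)
qed

lemma pi_cot_sums:
  fixes z :: complex
  assumes "z \<notin> \<int>"
  shows "(\<lambda>n. inverse (z + of_nat n) + inverse (z - of_nat (Suc n))) sums
    (of_real pi * cot (of_real pi * z))"
proof -
  have "1 - z \<noteq> 0" "z \<noteq> 0" using assms by auto
  then have "(\<lambda>N. \<Sum>n<N. inverse (z + of_nat n) - inverse (1 - z + of_nat n))
      \<longlonglongrightarrow> Digamma (1 - z) - Digamma z"
    using tendsto_diff[OF Digamma_LIMSEQ[of "1 - z"] Digamma_LIMSEQ[of z]]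
    by (simp add: sum_subtractf)
  moreover have "inverse (z - of_nat (Suc n)) = - inverse (1 - z + of_nat n)" for n
    by (simp flip: inverse_minus_eq)
  ultimately show ?thesis
    by (simp add: sums_def Digamma_reflection[OF assms])
qed

lemma pi_cot_eq_exp:
  fixes z :: complex
  assumes "exp z \<noteq> 1"
  shows "of_real pi * cot (of_real pi * (z / (2 * pi * \<i>))) = 2 * pi * \<i> * (1 / (exp z - 1) + 1 / 2)"
proof -
  define E where "E = exp (z / 2)"
  have E: "E \<noteq> 0" "E * E = exp z" "exp (- (z / 2)) = 1 / E"
    by (simp_all add: E_def exp_minus field_simps flip: exp_add)
  have z: "\<i> * (of_real pi * (z / (2 * pi * \<i>))) = z / 2" by simp
  have "E * E \<noteq> 1" using assms E by simp
  then show ?thesis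
    using E(1) unfolding cot_def sin_exp_eq cos_exp_eq z E(3) E_def[symmetric] E(2)[symmetric]
    by (simp add: divide_simps) (simp add: algebra_simps)
qed

lemma exp_partial_fractions_sums:
  fixes z :: complex
  assumes "exp z \<noteq> 1"
  shows "(\<lambda>n. inverse (z + 2 * pi * \<i> * of_nat n) + inverse (z - 2 * pi * \<i> * of_nat (Suc n))) sums
    (1 / (exp z - 1) + 1 / 2)"
proof -
  define u where "u = z / (2 * pi * \<i>)"
  have z: "z = 2 * pi * \<i> * u" by (simp add: u_def)
  have "u \<notin> \<int>"
  proof
    assume "u \<in> \<int>"
    then obtain n where "u = of_int n" by (auto elim: Ints_cases)
    then have "exp z = 1" unfolding z exp_eq_1 by (auto intro!: exI[of _ n])
    then show False using assms by simp
  qed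
  from sums_mult[OF pi_cot_sums[OF this], of "inverse (2 * pi * \<i>)"]
  have "(\<lambda>n. inverse (2 * pi * \<i>) * (inverse (u + of_nat n) + inverse (u - of_nat (Suc n)))) sums
      (inverse (2 * pi * \<i>) * (2 * pi * \<i> * (1 / (exp z - 1) + 1 / 2)))"
    unfolding pi_cot_eq_exp[OF assms, folded u_def] .
  also have "inverse (2 * pi * \<i>) * (2 * pi * \<i> * (1 / (exp z - 1) + 1 / 2)) = 1 / (exp z - 1) + 1 / 2"
    by (subst mult.assoc[symmetric], subst left_inverse) simp_all
  also have "(\<lambda>n. inverse (2 * pi * \<i>) * (inverse (u + of_nat n) + inverse (u - of_nat (Suc n)))) =
      (\<lambda>n. inverse (z + 2 * pi * \<i> * of_nat n) + inverse (z - 2 * pi * \<i> * of_nat (Suc n)))"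
  proof -
    have scale: "z + 2 * pi * \<i> * of_nat n = 2 * pi * \<i> * (u + of_nat n)"
      "z - 2 * pi * \<i> * of_nat (Suc n) = 2 * pi * \<i> * (u - of_nat (Suc n))" for n
      by (simp_all only: z distrib_left right_diff_distrib)
    show ?thesis unfolding scale inverse_mult_distrib by (simp only: distrib_left)
  qed
  finally show ?thesis .
qed

lemma has_sum_exp_partial_fractions:
  fixes w y :: real
  assumes "w > 0"
  shows "((\<lambda>k. 2 * w / (w\<^sup>2 + (y + 2 * pi * of_int k)\<^sup>2)) has_sum
    (1 + 2 * Re (1 / (exp (Complex w y) - 1)))) UNIV"
proof (rule nonneg_sums_imp_has_sum_int)
  define z where "z = Complex w y"
  define f where "f k = 2 * w / (w\<^sup>2 + (y + 2 * pi * of_int k)\<^sup>2)" for k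
  have "norm (exp z) > 1" using assms by (simp add: z_def)
  then have "exp z \<noteq> 1" by (metis less_irrefl norm_one)
  from sums_mult[OF sums_Re[OF exp_partial_fractions_sums[OF this]], of 2]
  have "(\<lambda>n. 2 * Re (inverse (z + 2 * pi * \<i> * of_nat n) +
      inverse (z - 2 * pi * \<i> * of_nat (Suc n)))) sums (2 * Re (1 / (exp z - 1) + 1 / 2))" .
  also have "2 * Re (1 / (exp z - 1) + 1 / 2) = 1 + 2 * Re (1 / (exp z - 1))" by simp
  also have "(\<lambda>n. 2 * Re (inverse (z + 2 * pi * \<i> * of_nat n) +
      inverse (z - 2 * pi * \<i> * of_nat (Suc n)))) = (\<lambda>n. f (int n) + f (- int (Suc n)))"
  proof -
    have "z + 2 * pi * \<i> * of_int k = Complex w (y + 2 * pi * of_int k)" for k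
      by (simp add: z_def complex_eq_iff)
    then have f_eq: "f k = 2 * Re (inverse (z + 2 * pi * \<i> * of_int k))" for k
      by (simp add: f_def)
    show ?thesis
      unfolding f_eq of_int_minus of_int_of_nat_eq mult_minus_right add_uminus_conv_diff
      by (simp only: plus_complex.simps distrib_left)
  qed
  finally show "(\<lambda>n. f (int n) + f (- int (Suc n))) sums (1 + 2 * Re (1 / (exp (Complex w y) - 1)))"
    by (simp only: z_def)
qed (use assms in simp)

definition exp_remainder :: "real \<Rightarrow> real" where
  "exp_remainder w = 1 / (exp w - 1) - 1 / w + 1 / 2"

lemma has_sum_exp_remainder:
  assumes "w > 0"
  shows "((\<lambda>k. 2 * w / (w\<^sup>2 + (2 * pi * real k)\<^sup>2)) has_sum exp_remainder w) {1..}"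
proof -
  have "complex_of_real w = Complex w 0" by (simp add: complex_eq_iff)
  then have "1 / (exp (Complex w 0) - 1) = complex_of_real (1 / (exp w - 1))"
    by (simp flip: exp_of_real)
  then have "((\<lambda>k. 2 * w / (w\<^sup>2 + (0 + 2 * pi * of_int k)\<^sup>2)) has_sum
      (1 + 2 * (1 / (exp w - 1)))) UNIV"
    using has_sum_exp_partial_fractions[OF assms, of 0] by simp
  from has_sum_int_even[OF this]
  have "((\<lambda>k. 2 * w / (w\<^sup>2 + (2 * pi * real k)\<^sup>2)) has_sum
      ((1 + 2 * (1 / (exp w - 1)) - 2 * w / w\<^sup>2) / 2)) {1..}"
    by simp
  also have "(1 + 2 * (1 / (exp w - 1)) - 2 * w / w\<^sup>2) / 2 = exp_remainder w"
    using assms by (simp add: exp_remainder_def power2_eq_square)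
  finally show ?thesis .
qed

lemma partial_fraction_term_inverse:
  fixes r w B :: real
  assumes "r > 0" "w > 0" "B > 0"
  shows "2 * (r / w) / ((r / w)\<^sup>2 + B\<^sup>2) = 2 * (r / B)\<^sup>2 / r * w / (w\<^sup>2 + (r / B)\<^sup>2)"
proof -
  have "(r / w)\<^sup>2 + B\<^sup>2 = (B / w)\<^sup>2 * (w\<^sup>2 + (r / B)\<^sup>2)"
    using assms by (simp add: power_mult_distrib power_divide distrib_left)
  then show ?thesis using assms by (simp add: power2_eq_square)
qed

lemma has_sum_exp_geometric:
  fixes z :: "'a::{real_normed_field, banach}"
  assumes "norm (exp (- z)) < 1"
  shows "((\<lambda>n. exp (- (of_nat n * z))) has_sum (1 / (exp z - 1))) {1..}"
proof -
  have "exp z - 1 \<noteq> 0" using assms by (auto simp: exp_minus)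
  then have "exp (- z) / (1 - exp (- z)) = 1 / (exp z - 1)"
    by (simp add: exp_minus field_simps)
  moreover have "exp (- (of_nat n * z)) = exp (- z) ^ n" for n
    using exp_of_nat_mult[of n "- z"] by simp
  ultimately show ?thesis using has_sum_geometric_from_1[OF assms] by simp
qed

lemma has_sum_exp_cos:
  fixes w y :: real
  assumes "w > 0"
  shows "((\<lambda>n. exp (- w * real n) * cos (real n * y)) has_sum Re (1 / (exp (Complex w y) - 1))) {1..}"
proof -
  have "norm (exp (- Complex w y)) < 1" using assms by simp
  from has_sum_Re[OF has_sum_exp_geometric[OF this]]
  show ?thesis by (simp add: Re_exp mult.commute)
qed

subsection \<open>Integrals over the half-line\<close>

abbreviation half_line :: "real measure" where
  "half_line \<equiv> restrict_space lborel {0<..}"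

lemma space_half_line: "space half_line = {0<..}"
  by (simp add: space_restrict_space)

lemma has_bochner_integral_half_line_iff:
  fixes f :: "real \<Rightarrow> 'a::{banach, second_countable_topology}"
  shows "has_bochner_integral half_line f I \<longleftrightarrow>
    set_integrable lborel {0<..} f \<and> (LBINT x:{0<..}. f x) = I"
  by (simp add: has_bochner_integral_iff integrable_restrict_space integral_restrict_space
      set_integrable_def set_lebesgue_integral_def)

lemma half_line_FTC_nonneg:
  fixes f F :: "real \<Rightarrow> real"
  assumes F: "\<And>x. x > 0 \<Longrightarrow> (F has_real_derivative f x) (at x)"
    and f: "\<And>x. x > 0 \<Longrightarrow> isCont f x"
    and nonneg: "\<And>x. x > 0 \<Longrightarrow> f x \<ge> 0"
    and A: "(F \<longlongrightarrow> A) (at_right 0)" and B: "(F \<longlongrightarrow> B) at_top"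
  shows "has_bochner_integral half_line f (B - A)"
proof -
  have A_ereal: "((F \<circ> real_of_ereal) \<longlongrightarrow> A) (at_right (ereal 0))"
    and B_ereal: "((F \<circ> real_of_ereal) \<longlongrightarrow> B) (at_left \<infinity>)"
    using A B by (simp_all add: ereal_tendsto_simps)
  have einterval: "einterval (ereal 0) \<infinity> = {0<..}" by (auto simp: einterval_def)
  note FTC = interval_integral_FTC_nonneg[of "ereal 0" \<infinity> F f, OF _ _ _ _ A_ereal B_ereal]
  have "set_integrable lborel {0<..} f"
    using FTC(1) F f nonneg by (simp add: einterval)
  moreover have "(LBINT x:{0<..}. f x) = B - A"
    using FTC(2) F f nonneg by (simp add: interval_lebesgue_integral_le_eq einterval)
  ultimately show ?thesis by (simp add: has_bochner_integral_half_line_iff)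
qed

lemma half_line_substitution_exp:
  fixes f :: "real \<Rightarrow> real"
  assumes "p > 0" and cont: "\<And>x. x > 0 \<Longrightarrow> isCont f x" and nonneg: "\<And>x. x > 0 \<Longrightarrow> f x \<ge> 0"
    and I: "has_bochner_integral lborel (\<lambda>t. f (p * exp t) * (p * exp t)) I"
  shows "has_bochner_integral half_line f I"
proof -
  have einterval: "einterval (ereal 0) \<infinity> = {0<..}" "einterval (-\<infinity>) \<infinity> = UNIV"
    by (auto simp: einterval_def)
  have limits: "((ereal \<circ> (\<lambda>t. p * exp t) \<circ> real_of_ereal) \<longlongrightarrow> ereal 0) (at_right (- \<infinity>))"
    "((ereal \<circ> (\<lambda>t. p * exp t) \<circ> real_of_ereal) \<longlongrightarrow> \<infinity>) (at_left \<infinity>)"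
    unfolding ereal_tendsto_simps using \<open>p > 0\<close> by real_asymp+
  have deriv: "((\<lambda>t. p * exp t) has_real_derivative p * exp t) (at t)" for t
    by (auto intro!: derivative_eq_intros)
  have "set_integrable lborel (einterval (-\<infinity>) \<infinity>) (\<lambda>t. f (p * exp t) * (p * exp t))"
    using I by (simp add: einterval set_integrable_def has_bochner_integral_iff)
  note substitution = interval_integral_substitution_nonneg
    [of "-\<infinity>" \<infinity> "\<lambda>t. p * exp t" "\<lambda>t. p * exp t" f, OF _ deriv _ _ _ _ limits this]
  have "set_integrable lborel {0<..} f"
    using substitution(1) cont nonneg \<open>p > 0\<close> by (simp add: einterval)
  moreover have "(LBINT u:{0<..}. f u) = (LBINT t:UNIV. f (p * exp t) * (p * exp t))"
    using substitution(2) cont nonneg \<open>p > 0\<close> by (simp add: interval_lebesgue_integral_le_eq einterval)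
  ultimately show ?thesis
    using has_bochner_integral_integral_eq[OF I]
    by (simp add: has_bochner_integral_half_line_iff set_lebesgue_integral_def)
qed

lemma half_line_integral_exp:
  fixes s :: real
  assumes "s > 0"
  shows "has_bochner_integral half_line (\<lambda>u. exp (- s * u)) (1 / s)"
proof -
  have "has_bochner_integral half_line (\<lambda>u. exp (- s * u)) (0 - (- 1 / s))"
  proof (rule half_line_FTC_nonneg[where F = "\<lambda>u. - exp (- s * u) / s"])
    show "((\<lambda>u. - exp (- s * u) / s) has_real_derivative exp (- s * x)) (at x)" for x
      using assms by (auto intro!: derivative_eq_intros)
    show "((\<lambda>u. - exp (- s * u) / s) \<longlongrightarrow> - 1 / s) (at_right 0)"
      using assms by (auto intro!: tendsto_eq_intros)
    show "((\<lambda>u. - exp (- s * u) / s) \<longlongrightarrow> 0) at_top"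
      using assms by real_asymp
  qed auto
  then show ?thesis by simp
qed

lemma half_line_integral_inverse_square_plus:
  fixes a :: real
  assumes "a > 0"
  shows "has_bochner_integral half_line (\<lambda>x. 1 / (x\<^sup>2 + a\<^sup>2)) (pi / (2 * a))"
proof -
  define F where "F x = arctan (x / a) / a" for x
  have pos: "x\<^sup>2 + a\<^sup>2 > 0" for x using assms by (simp add: add_nonneg_pos)
  have "has_bochner_integral half_line (\<lambda>x. 1 / (x\<^sup>2 + a\<^sup>2)) (pi / (2 * a) - 0)"
  proof (rule half_line_FTC_nonneg[where F = F])
    fix x
    have "1 + (x / a)\<^sup>2 = (x\<^sup>2 + a\<^sup>2) / a\<^sup>2"
      using assms by (simp add: field_simps)
    then have "inverse (1 + (x / a)\<^sup>2) / a / a = 1 / (x\<^sup>2 + a\<^sup>2)"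
      using assms pos[of x] by (simp add: power2_eq_square)
    moreover have "(F has_real_derivative inverse (1 + (x / a)\<^sup>2) / a / a) (at x)"
      unfolding F_def using assms by (auto intro!: derivative_eq_intros)
    ultimately show "(F has_real_derivative 1 / (x\<^sup>2 + a\<^sup>2)) (at x)" by simp
    show "isCont (\<lambda>x. 1 / (x\<^sup>2 + a\<^sup>2)) x"
      using pos[of x] by (intro continuous_intros) auto
    show "(F \<longlongrightarrow> 0) (at_right 0)" "(F \<longlongrightarrow> pi / (2 * a)) at_top"
      unfolding F_def using assms by (real_asymp simp: field_simps)+
  qed (use pos in simp)
  then show ?thesis by simp
qed

lemma half_line_integral_square_plus_product:
  fixes a b :: real
  assumes "a > 0" "b > 0" "a \<noteq> b"
  shows "has_bochner_integral half_line (\<lambda>x. x / ((x\<^sup>2 + a\<^sup>2) * (x\<^sup>2 + b\<^sup>2)))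
    (ln (a / b) / (a\<^sup>2 - b\<^sup>2))"
proof -
  define D where "D = a\<^sup>2 - b\<^sup>2"
  define F where "F x = (ln (x\<^sup>2 + b\<^sup>2) - ln (x\<^sup>2 + a\<^sup>2)) / (2 * D)" for x
  have "D \<noteq> 0" using assms by (simp add: D_def power2_eq_iff)
  have pos: "x\<^sup>2 + a\<^sup>2 > 0" "x\<^sup>2 + b\<^sup>2 > 0" for x
    using assms by (simp_all add: add_nonneg_pos)
  have "has_bochner_integral half_line (\<lambda>x. x / ((x\<^sup>2 + a\<^sup>2) * (x\<^sup>2 + b\<^sup>2))) (0 - F 0)"
  proof (rule half_line_FTC_nonneg[where F = F])
    fix x
    have "(F has_real_derivative (2 * x / (x\<^sup>2 + b\<^sup>2) - 2 * x / (x\<^sup>2 + a\<^sup>2)) / (2 * D)) (at x)"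
      unfolding F_def using pos[of x]
      by (intro DERIV_cdivide DERIV_diff) (auto intro!: derivative_eq_intros)
    also have "2 * x / (x\<^sup>2 + b\<^sup>2) - 2 * x / (x\<^sup>2 + a\<^sup>2) = 2 * D * (x / ((x\<^sup>2 + a\<^sup>2) * (x\<^sup>2 + b\<^sup>2)))"
      using pos[of x] by (subst diff_frac_eq) (auto simp: D_def algebra_simps)
    finally show "(F has_real_derivative x / ((x\<^sup>2 + a\<^sup>2) * (x\<^sup>2 + b\<^sup>2))) (at x)"
      using \<open>D \<noteq> 0\<close> by simp
    show "isCont (\<lambda>x. x / ((x\<^sup>2 + a\<^sup>2) * (x\<^sup>2 + b\<^sup>2))) x"
      using pos[of x] by (intro continuous_intros) auto
    show "x / ((x\<^sup>2 + a\<^sup>2) * (x\<^sup>2 + b\<^sup>2)) \<ge> 0" if "x > 0"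
      using pos[of x] that by simp
    have "((\<lambda>x. ln (x\<^sup>2 + b\<^sup>2) - ln (x\<^sup>2 + a\<^sup>2)) \<longlongrightarrow> 0) at_top"
      using assms by real_asymp
    then show "(F \<longlongrightarrow> 0) at_top"
      unfolding F_def by (rule tendsto_divide_zero)
    have "isCont F 0"
      unfolding F_def using pos[of 0] \<open>D \<noteq> 0\<close> by (intro continuous_intros) auto
    then show "(F \<longlongrightarrow> F 0) (at_right 0)"
      unfolding isCont_def by (rule filterlim_mono) (auto simp: at_le)
  qed
  also have "0 - F 0 = ln (a / b) / D"
    using assms \<open>D \<noteq> 0\<close> by (simp add: F_def ln_div ln_realpow field_simps)
  finally show ?thesis by (simp add: D_def)
qed

subsection \<open>Integral representations of the Bessel function\<close>

lemma power_le_fact_mult_exp: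
  fixes y :: real
  assumes "y \<ge> 0"
  shows "y ^ n \<le> fact n * exp y"
proof -
  have "(\<Sum>k\<in>{n}. y ^ k /\<^sub>R fact k) \<le> exp y"
    unfolding exp_def using assms by (intro sum_le_suminf summable_exp_generic) auto
  then show ?thesis by (simp add: field_simps)
qed

lemma exp_minus_mult_cosh_le:
  fixes z t :: real
  assumes "z > 0"
  shows "exp (- z * cosh t) \<le> fact n * (2 / z) ^ n * exp (- real n * t)"
proof -
  have "(z * exp t / 2) ^ n \<le> (z * cosh t) ^ n"
    using assms by (intro power_mono) (auto simp: cosh_def)
  also have "\<dots> \<le> fact n * exp (z * cosh t)"
    using assms by (intro power_le_fact_mult_exp) (simp add: less_imp_le)
  finally show ?thesis
    using assms
    by (simp add: exp_minus power_mult_distrib power_divide exp_of_nat_mult exp_of_nat2_mult field_simps)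
qed

lemma half_line_integral_exp_cosh:
  assumes "z > 0"
  shows "has_bochner_integral half_line (\<lambda>t. exp (- z * cosh t)) (bessel_K0 z)"
proof -
  have "integrable half_line (\<lambda>t. 2 / z * exp (- 1 * t))"
    using half_line_integral_exp[of 1]
    by (intro integrable_mult_right) (auto intro: integrable.intros)
  then have "integrable half_line (\<lambda>t. exp (- z * cosh t))"
  proof (rule Bochner_Integration.integrable_bound)
    show "AE t in half_line. norm (exp (- z * cosh t)) \<le> norm (2 / z * exp (- 1 * t))"
      using exp_minus_mult_cosh_le[OF assms, of _ 1] assms by simp
  qed (simp add: cosh_def measurable_restrict_space1)
  then have integrable: "set_integrable lborel {0<..} (\<lambda>t. exp (- z * cosh t))"
    by (simp add: integrable_restrict_space set_integrable_def)
  then have "(LBINT t:{0<..}. exp (- z * cosh t)) = integral {0<..} (\<lambda>t. exp (- z * cosh t))"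
    by (rule set_borel_integral_eq_integral)
  also have "\<dots> = bessel_K0 z"
    unfolding bessel_K0_def by (rule integral_spike_set) (auto intro: negligible_subset[of "{0}"])
  finally show ?thesis
    using integrable by (simp add: has_bochner_integral_half_line_iff)
qed

lemma bessel_K0_le:
  assumes "z > 0"
  shows "bessel_K0 z \<le> fact n * (2 / z) ^ Suc n"
proof -
  note K = half_line_integral_exp_cosh[OF assms]
  have bound: "has_bochner_integral half_line
      (\<lambda>t. fact (Suc n) * (2 / z) ^ Suc n * exp (- real (Suc n) * t))
      (fact (Suc n) * (2 / z) ^ Suc n * (1 / real (Suc n)))"
    by (intro has_bochner_integral_mult_right half_line_integral_exp) simp
  have "(LINT t|half_line. exp (- z * cosh t)) \<le>
      (LINT t|half_line. fact (Suc n) * (2 / z) ^ Suc n * exp (- real (Suc n) * t))"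
    by (intro integral_mono integrable.intros[OF K] integrable.intros[OF bound]
        exp_minus_mult_cosh_le assms)
  then have "bessel_K0 z \<le> fact (Suc n) * (2 / z) ^ Suc n * (1 / real (Suc n))"
    by (simp only: has_bochner_integral_integral_eq[OF K] has_bochner_integral_integral_eq[OF bound])
  then show ?thesis by (simp del: of_nat_Suc power_Suc)
qed

lemma real_line_integral_exp_cosh:
  assumes "z > 0"
  shows "has_bochner_integral lborel (\<lambda>t. exp (- z * cosh t)) (2 * bessel_K0 z)"
proof -
  have "has_bochner_integral lborel (\<lambda>t. indicator {0<..} t *\<^sub>R exp (- z * cosh t)) (bessel_K0 z)"
    using half_line_integral_exp_cosh[OF assms]
    by (simp add: has_bochner_integral_iff integrable_restrict_space integral_restrict_space)
  then have "has_bochner_integral lborel (\<lambda>t. indicator {0..} t *\<^sub>R exp (- z * cosh t)) (bessel_K0 z)"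
    by (rule has_bochner_integral_discrete_difference[where X = "{0}", THEN iffD1, rotated 4])
       (auto split: split_indicator)
  from has_bochner_integral_even_function[OF this] show ?thesis by simp
qed

lemma half_line_integral_bessel_K0:
  fixes s r :: real
  assumes "s > 0" "r > 0"
  shows "has_bochner_integral half_line (\<lambda>u. exp (- s * u - r / u) / u)
    (2 * bessel_K0 (2 * sqrt (s * r)))"
proof -
  define z where "z = 2 * sqrt (s * r)"
  define p where "p = sqrt (r / s)"
  have z: "z > 0" and p: "p > 0" using assms by (simp_all add: z_def p_def)
  have rescaled: "s * p = z / 2" "r / p = z / 2"
    using assms by (simp_all add: z_def p_def real_sqrt_divide real_sqrt_mult field_simps)
  have "exp (- s * (p * exp t) - r / (p * exp t)) / (p * exp t) * (p * exp t) = exp (- z * cosh t)" for t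
  proof -
    have "- s * (p * exp t) - r / (p * exp t) = - (s * p) * exp t - (r / p) * exp (- t)"
      by (simp add: exp_minus field_simps)
    also have "\<dots> = - z * cosh t" unfolding rescaled by (simp add: cosh_def field_simps)
    finally show ?thesis using p by simp
  qed
  then have "has_bochner_integral half_line (\<lambda>u. exp (- s * u - r / u) / u) (2 * bessel_K0 z)"
    using real_line_integral_exp_cosh[OF z]
    by (intro half_line_substitution_exp[OF p]) (auto intro!: continuous_intros)
  then show ?thesis by (simp add: z_def)
qed

subsection \<open>Termwise integration\<close>

lemma norm_sum_scaleR_decseq_le:
  fixes a :: "nat \<Rightarrow> 'a::real_normed_vector" and b :: "nat \<Rightarrow> real"
  assumes bound: "\<And>N. norm (\<Sum>n<N. a n) \<le> C" and dec: "decseq b" and nonneg: "\<And>n. b n \<ge> 0"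
  shows "norm (\<Sum>n<N. b n *\<^sub>R a n) \<le> b 0 * C"
proof -
  define A where "A N = (\<Sum>n<N. a n)" for N
  have "(\<Sum>n<N. b n *\<^sub>R a n) = b N *\<^sub>R A N + (\<Sum>n<N. (b n - b (Suc n)) *\<^sub>R A (Suc n))"
    by (induction N) (simp_all add: A_def algebra_simps)
  also have "norm \<dots> \<le> norm (b N *\<^sub>R A N) + (\<Sum>n<N. norm ((b n - b (Suc n)) *\<^sub>R A (Suc n)))"
    by (rule order_trans[OF norm_triangle_ineq add_left_mono[OF norm_sum]])
  also have "\<dots> \<le> b N * C + (\<Sum>n<N. (b n - b (Suc n)) * C)"
    unfolding norm_scaleR using dec nonneg bound
    by (intro add_mono sum_mono mult_mono) (auto simp: A_def decseq_Suc_iff simp del: sum.lessThan_Suc)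
  also have "\<dots> = b 0 * C"
    by (simp add: sum_lessThan_telescope' flip: sum_distrib_right) (simp add: algebra_simps)
  finally show ?thesis .
qed

lemma has_bochner_integral_sums_decseq:
  fixes a :: "nat \<Rightarrow> 'b::{banach, second_countable_topology}" and f :: "nat \<Rightarrow> 'a \<Rightarrow> real"
  assumes bound: "\<And>N. norm (\<Sum>n<N. a n) \<le> C"
    and integral: "\<And>n. has_bochner_integral M (f n) (I n)"
    and dec: "\<And>x. x \<in> space M \<Longrightarrow> decseq (\<lambda>n. f n x)"
    and nonneg: "\<And>n x. x \<in> space M \<Longrightarrow> f n x \<ge> 0"
    and F: "\<And>x. x \<in> space M \<Longrightarrow> (\<lambda>n. f n x *\<^sub>R a n) sums F x"
  shows "has_bochner_integral M F (\<Sum>n. I n *\<^sub>R a n)"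
proof -
  define s where "s N x = (\<Sum>n<N. f n x *\<^sub>R a n)" for N x
  have s: "has_bochner_integral M (s N) (\<Sum>n<N. I n *\<^sub>R a n)" for N
    unfolding s_def by (intro has_bochner_integral_sum has_bochner_integral_scaleR_left integral)
  then have s_measurable: "s N \<in> borel_measurable M" for N
    by (rule borel_measurable_has_bochner_integral)
  have limit: "(\<lambda>N. s N x) \<longlonglongrightarrow> F x" if "x \<in> space M" for x
    using F[OF that] by (simp add: sums_def s_def)
  have F_measurable: "F \<in> borel_measurable M"
    by (rule borel_measurable_LIMSEQ_metric[OF s_measurable limit])
  have majorant: "integrable M (\<lambda>x. f 0 x * C)"
    using integral by (intro integrable_mult_left) (auto simp: has_bochner_integral_iff)
  have dominated: "norm (s N x) \<le> f 0 x * C" if "x \<in> space M" for N x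
    unfolding s_def using bound dec[OF that] nonneg[OF that] by (rule norm_sum_scaleR_decseq_le)
  have "(\<lambda>N. integral\<^sup>L M (s N)) \<longlonglongrightarrow> integral\<^sup>L M F"
    by (rule integral_dominated_convergence[of F M s "\<lambda>x. f 0 x * C",
          OF F_measurable s_measurable majorant])
       (use limit dominated in auto)
  then have "(\<lambda>n. I n *\<^sub>R a n) sums integral\<^sup>L M F"
    using s by (simp add: sums_def has_bochner_integral_iff)
  moreover have "integrable M F"
    by (rule integrable_dominated_convergence[of F M s "\<lambda>x. f 0 x * C",
          OF F_measurable s_measurable majorant])
       (use limit dominated in auto)
  ultimately show ?thesis by (simp add: has_bochner_integral_iff sums_iff)
qed

lemma has_sum_integral_infinite:
  fixes F :: "'i \<Rightarrow> 'a \<Rightarrow> 'b::{banach, second_countable_topology}"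
  assumes I: "countable I" "infinite I"
    and integrable: "\<And>i. i \<in> I \<Longrightarrow> integrable M (F i)"
    and summable: "(\<lambda>i. \<integral>x. norm (F i x) \<partial>M) summable_on I"
    and abs: "\<And>x. x \<in> space M \<Longrightarrow> (\<lambda>i. norm (F i x)) summable_on I"
    and G: "\<And>x. x \<in> space M \<Longrightarrow> ((\<lambda>i. F i x) has_sum G x) I"
  shows "integrable M G" and "((\<lambda>i. integral\<^sup>L M (F i)) has_sum integral\<^sup>L M G) I"
proof -
  define e where "e = from_nat_into I"
  have e: "bij_betw e UNIV I" unfolding e_def by (rule bij_betw_from_nat_into[OF I])
  then have "e n \<in> I" for n by (auto simp: bij_betw_def)
  then have F_e: "integrable M (F (e n))" for n by (rule integrable)
  have "(\<lambda>n. norm (F (e n) x)) summable_on UNIV" if "x \<in> space M" for x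
    using abs[OF that] by (subst summable_on_reindex_bij_betw[OF e])
  then have abs_e: "AE x in M. summable (\<lambda>n. norm (F (e n) x))"
    by (simp add: summable_on_imp_summable)
  have "(\<lambda>n. \<integral>x. norm (F (e n) x) \<partial>M) summable_on UNIV"
    using summable by (subst summable_on_reindex_bij_betw[OF e])
  then have summable_e: "summable (\<lambda>n. \<integral>x. norm (F (e n) x) \<partial>M)"
    by (rule summable_on_imp_summable)
  have "((\<lambda>n. F (e n) x) has_sum G x) UNIV" if "x \<in> space M" for x
    using G[OF that] by (subst has_sum_reindex_bij_betw[OF e])
  then have G_e: "(\<Sum>n. F (e n) x) = G x" if "x \<in> space M" for x
    using that has_sum_imp_sums sums_unique by metis
  show "integrable M G"
    using integrable_suminf[OF F_e abs_e summable_e]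
      Bochner_Integration.integrable_cong[OF refl G_e, of M] by simp
  have "(\<lambda>n. integral\<^sup>L M (F (e n))) sums (\<integral>x. (\<Sum>n. F (e n) x) \<partial>M)"
    by (rule sums_integral[OF F_e abs_e summable_e])
  also have "(\<integral>x. (\<Sum>n. F (e n) x) \<partial>M) = integral\<^sup>L M G"
    by (rule Bochner_Integration.integral_cong[OF refl G_e])
  finally have "(\<lambda>n. integral\<^sup>L M (F (e n))) sums integral\<^sup>L M G" .
  moreover have "summable (\<lambda>n. norm (integral\<^sup>L M (F (e n))))"
    by (rule summable_comparison_test'[OF summable_e]) simp
  ultimately have "((\<lambda>n. integral\<^sup>L M (F (e n))) has_sum integral\<^sup>L M G) UNIV"
    by (intro norm_summable_imp_has_sum)
  then show "((\<lambda>i. integral\<^sup>L M (F i)) has_sum integral\<^sup>L M G) I"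
    by (subst (asm) has_sum_reindex_bij_betw[OF e])
qed

lemma has_sum_integral:
  fixes F :: "'i \<Rightarrow> 'a \<Rightarrow> 'b::{banach, second_countable_topology}"
  assumes "countable I"
    and integrable: "\<And>i. i \<in> I \<Longrightarrow> integrable M (F i)"
    and summable: "(\<lambda>i. \<integral>x. norm (F i x) \<partial>M) summable_on I"
    and abs: "\<And>x. x \<in> space M \<Longrightarrow> (\<lambda>i. norm (F i x)) summable_on I"
    and G: "\<And>x. x \<in> space M \<Longrightarrow> ((\<lambda>i. F i x) has_sum G x) I"
  shows "integrable M G" and "((\<lambda>i. integral\<^sup>L M (F i)) has_sum integral\<^sup>L M G) I"
proof -
  have "integrable M G \<and> ((\<lambda>i. integral\<^sup>L M (F i)) has_sum integral\<^sup>L M G) I"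
  proof (cases "finite I")
    case True
    have G_eq: "G x = (\<Sum>i\<in>I. F i x)" if "x \<in> space M" for x
      using G[OF that] has_sum_finite[OF True] by (rule has_sum_unique)
    have "has_bochner_integral M (\<lambda>x. \<Sum>i\<in>I. F i x) (\<Sum>i\<in>I. integral\<^sup>L M (F i))"
      by (intro has_bochner_integral_sum has_bochner_integral_integrable integrable)
    then have "has_bochner_integral M G (\<Sum>i\<in>I. integral\<^sup>L M (F i))"
      by (subst has_bochner_integral_cong[OF refl G_eq refl])
    then show ?thesis
      using True by (auto simp: has_bochner_integral_iff intro: has_sum_finiteI)
  next
    case False
    show ?thesis
      using has_sum_integral_infinite[OF \<open>countable I\<close> False integrable summable abs G] by blast
  qed
  then show "integrable M G" and "((\<lambda>i. integral\<^sup>L M (F i)) has_sum integral\<^sup>L M G) I"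
    by blast+
qed

lemma integral_norm_mult_of_real_le:
  fixes c :: complex and f :: "'a \<Rightarrow> real"
  assumes "norm c \<le> 1" and nonneg: "\<And>x. x \<in> space M \<Longrightarrow> f x \<ge> 0"
    and I: "has_bochner_integral M f I"
  shows "(\<integral>x. norm (c * of_real (f x)) \<partial>M) \<le> I"
proof -
  have "(\<integral>x. norm (c * of_real (f x)) \<partial>M) = (\<integral>x. norm c * f x \<partial>M)"
    using nonneg by (intro Bochner_Integration.integral_cong) (simp_all add: norm_mult)
  also have "\<dots> = norm c * I"
    by (simp add: has_bochner_integral_integral_eq[OF I])
  also have "\<dots> \<le> 1 * I"
    using \<open>norm c \<le> 1\<close> Bochner_Integration.integral_nonneg[of M f] nonneg
    by (intro mult_right_mono) (simp_all add: has_bochner_integral_integral_eq[OF I])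
  finally show ?thesis by simp
qed

lemma has_sum_integral_product:
  fixes a :: "'i \<Rightarrow> complex" and f :: "'i \<Rightarrow> 'a \<Rightarrow> real" and g :: "'j \<Rightarrow> 'a \<Rightarrow> real"
  assumes "countable A" "countable B"
    and a: "\<And>i. norm (a i) \<le> 1"
    and nonneg: "\<And>i x. x \<in> space M \<Longrightarrow> f i x \<ge> 0" "\<And>j x. x \<in> space M \<Longrightarrow> g j x \<ge> 0"
    and integral: "\<And>i j. i \<in> A \<Longrightarrow> j \<in> B \<Longrightarrow> has_bochner_integral M (\<lambda>x. f i x * g j x) (K i j)"
    and K: "(\<lambda>(i, j). K i j) summable_on A \<times> B"
    and F: "\<And>x. x \<in> space M \<Longrightarrow> ((\<lambda>i. a i * of_real (f i x)) has_sum F x) A"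
    and G: "\<And>x. x \<in> space M \<Longrightarrow> ((\<lambda>j. g j x) has_sum G x) B"
  shows "integrable M (\<lambda>x. F x * of_real (G x))"
    and "((\<lambda>(i, j). a i * of_real (K i j)) has_sum (\<integral>x. F x * of_real (G x) \<partial>M)) (A \<times> B)"
proof -
  define h where "h = (\<lambda>(i, j) x. a i * of_real (f i x * g j x))"
  have h: "has_bochner_integral M (h (i, j)) (a i * of_real (K i j))" if "(i, j) \<in> A \<times> B" for i j
    unfolding h_def prod.case using that
    by (intro has_bochner_integral_mult_right has_bochner_integral_of_real integral) auto
  then have h_integrable: "integrable M (h p)" if "p \<in> A \<times> B" for p
    using that by (cases p) (auto intro: integrable.intros)
  have integrals_summable: "(\<lambda>p. \<integral>x. norm (h p x) \<partial>M) summable_on A \<times> B"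
  proof (rule summable_on_comparison_test[OF K])
    fix p assume "p \<in> A \<times> B"
    then obtain i j where ij: "p = (i, j)" "i \<in> A" "j \<in> B" by auto
    show "(\<integral>x. norm (h p x) \<partial>M) \<le> (case p of (i, j) \<Rightarrow> K i j)"
      unfolding h_def ij(1) prod.case
      by (intro integral_norm_mult_of_real_le a integral ij mult_nonneg_nonneg nonneg)
  qed simp
  have h_has_sum: "((\<lambda>p. h p x) has_sum F x * of_real (G x)) (A \<times> B)" if "x \<in> space M" for x
    using has_sum_Times_of_real[OF F[OF that] G[OF that]]
    by (simp add: h_def case_prod_unfold mult.assoc)
  have h_abs: "(\<lambda>p. norm (h p x)) summable_on A \<times> B" if "x \<in> space M" for x
    using has_sum_imp_summable[OF h_has_sum[OF that]]
    by (simp only: summable_on_iff_abs_summable_on_complex)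
  note interchange = has_sum_integral[OF countable_SIGMA[OF assms(1,2)] h_integrable
      integrals_summable h_abs h_has_sum]
  show "integrable M (\<lambda>x. F x * of_real (G x))" by (rule interchange)
  show "((\<lambda>(i, j). a i * of_real (K i j)) has_sum (\<integral>x. F x * of_real (G x) \<partial>M)) (A \<times> B)"
    by (rule has_sum_cong[THEN iffD1, OF _ interchange(2)])
       (use has_bochner_integral_integral_eq[OF h] in auto)
qed

lemma has_sum_integral_divisor_sum:
  fixes a :: "nat \<Rightarrow> complex" and f g :: "nat \<Rightarrow> 'a \<Rightarrow> real" and K :: "nat \<Rightarrow> real"
  assumes a: "\<And>m. norm (a m) \<le> 1"
    and nonneg: "\<And>m x. x \<in> space M \<Longrightarrow> f m x \<ge> 0" "\<And>n x. x \<in> space M \<Longrightarrow> g n x \<ge> 0"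
    and integral: "\<And>m n. m \<ge> 1 \<Longrightarrow> n \<ge> 1 \<Longrightarrow> has_bochner_integral M (\<lambda>x. f m x * g n x) (K (m * n))"
    and decay: "\<And>n. n \<ge> 1 \<Longrightarrow> K n \<le> C * real n powr - p" and "p > 1"
    and F: "\<And>x. x \<in> space M \<Longrightarrow> ((\<lambda>m. a m * of_real (f m x)) has_sum F x) {1..}"
    and G: "\<And>x. x \<in> space M \<Longrightarrow> ((\<lambda>n. g n x) has_sum G x) {1..}"
  shows "integrable M (\<lambda>x. F x * of_real (G x))"
    and "((\<lambda>n. (\<Sum>d | d dvd n. a d) * of_real (K n)) has_sum (\<integral>x. F x * of_real (G x) \<partial>M)) {1..}"
proof -
  have powr_summable: "(\<lambda>n. real n powr - p) summable_on {1..}"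
    using \<open>p > 1\<close> by (intro summable_on_subset_banach[OF summable_nonneg_imp_summable_on])
      (simp_all add: summable_real_powr_iff)
  have "(\<lambda>(m, n). real m powr - p * real n powr - p) summable_on {1..} \<times> {1..}"
    by (rule nonneg_summable_on_Times[OF powr_summable powr_ge_zero powr_summable powr_ge_zero])
  from summable_on_cmult_right[OF this, of C]
  have K: "(\<lambda>(m, n). K (m * n)) summable_on {1..} \<times> {1..}"
  proof (rule summable_on_comparison_test)
    fix k assume "k \<in> {1::nat..} \<times> {1::nat..}"
    then obtain m n where mn: "k = (m, n)" "m \<ge> 1" "n \<ge> 1" "m * n \<ge> 1" by auto
    show "(case k of (m, n) \<Rightarrow> K (m * n)) \<le> C * (case k of (m, n) \<Rightarrow> real m powr - p * real n powr - p)"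
      using decay[OF mn(4)] by (simp add: mn(1) powr_mult)
    show "(case k of (m, n) \<Rightarrow> K (m * n)) \<ge> 0"
      using has_bochner_integral_integral_eq[OF integral[OF mn(2,3)], symmetric] nonneg
      by (simp add: mn(1) Bochner_Integration.integral_nonneg)
  qed
  have integral_mem: "has_bochner_integral M (\<lambda>x. f m x * g n x) (K (m * n))"
    if "m \<in> {1..}" "n \<in> {1..}" for m n
    using that by (simp add: integral)
  note product = has_sum_integral_product[OF countableI_type countableI_type a nonneg integral_mem K F G]
  show "integrable M (\<lambda>x. F x * of_real (G x))" by (rule product)
  show "((\<lambda>n. (\<Sum>d | d dvd n. a d) * of_real (K n)) has_sum (\<integral>x. F x * of_real (G x) \<partial>M)) {1..}"
    using product(2) by (rule has_sum_divisor_sum)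
qed

subsection \<open>The functional equation of theta\<close>

context even_primitive_dirichlet_char
begin

definition theta :: "real \<Rightarrow> complex" where
  "theta w = (\<Sum>\<^sub>\<infinity>d\<in>{1::nat..}. chi (int d) * of_real (exp (- w * real d)))"

text \<open>Normalised to have integral $1/n$ over the half-line.\<close>

definition dual_kernel :: "nat \<Rightarrow> real \<Rightarrow> real" where
  "dual_kernel n w = 4 / (real q * (w\<^sup>2 + (2 * pi * real n / real q)\<^sup>2))"

definition theta_dual :: "real \<Rightarrow> complex" where
  "theta_dual w = (\<Sum>\<^sub>\<infinity>n\<in>{1::nat..}. conj_character chi (int n) * of_real (dual_kernel n w))"

sublocale conj: dirichlet_char q "conj_character chi"
  by (rule dirichlet_char_conj)

lemma conj_nonprincipal: "\<not> principal_character q (conj_character chi)"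
  using nonprincipal by (auto simp: principal_character_def conj_character_def complex_eq_iff)

definition theta_fourier :: "real \<Rightarrow> complex" where
  "theta_fourier w = (\<Sum>n\<in>{0..<int q}. cnj (chi n) *
     of_real (Re (1 / (exp (Complex w (2 * pi * of_int n / of_nat q)) - 1))))"

lemma has_sum_theta_fourier:
  assumes "w > 0"
  shows "((\<lambda>d. chi (int d) * of_real (exp (- w * real d))) has_sum
    (gauss_sum q chi / of_nat q * theta_fourier w)) {1..}"
proof -
  have "((\<lambda>d. gauss_sum q chi / of_nat q * (\<Sum>n\<in>{0..<int q}. cnj (chi n) *
        of_real (exp (- w * real d) * cos (real d * (2 * pi * of_int n / of_nat q))))) has_sum
      (gauss_sum q chi / of_nat q * theta_fourier w)) {1..}"
    unfolding theta_fourier_def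
    by (intro has_sum_cmult_right has_sum_sum has_sum_of_real has_sum_exp_cos assms)
  also have "(\<lambda>d. gauss_sum q chi / of_nat q * (\<Sum>n\<in>{0..<int q}. cnj (chi n) *
        of_real (exp (- w * real d) * cos (real d * (2 * pi * of_int n / of_nat q))))) =
      (\<lambda>d. chi (int d) * of_real (exp (- w * real d)))"
    by (subst chi_cos_expansion) (simp add: sum_distrib_left sum_distrib_right mult_ac)
  finally show ?thesis .
qed

lemma has_sum_int_theta_fourier:
  assumes "w > 0"
  shows "((\<lambda>m. cnj (chi m) * of_real (2 * w / (w\<^sup>2 + (2 * pi * of_int m / real q)\<^sup>2))) has_sum
    (2 * theta_fourier w)) UNIV"
proof -
  define R where "R n = Re (1 / (exp (Complex w (2 * pi * of_int n / of_nat q)) - 1))" for n :: int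
  have "((\<lambda>m. cnj (chi m) * of_real (2 * w / (w\<^sup>2 + (2 * pi * of_int m / real q)\<^sup>2))) has_sum
      (\<Sum>n\<in>{0..<int q}. cnj (chi n) * of_real (1 + 2 * R n))) UNIV"
  proof (rule has_sum_int_residues)
    fix n
    have "chi (n + int q * k) = chi n" for k by (rule chi_cong) (simp add: cong_def)
    moreover have "2 * pi * of_int (n + int q * k) / real q =
        2 * pi * of_int n / real q + 2 * pi * of_int k" for k
      using q_pos by (simp add: field_simps)
    ultimately show "((\<lambda>k. cnj (chi (n + int q * k)) *
        of_real (2 * w / (w\<^sup>2 + (2 * pi * of_int (n + int q * k) / real q)\<^sup>2))) has_sum
        cnj (chi n) * of_real (1 + 2 * R n)) UNIV"
      unfolding R_def using has_sum_exp_partial_fractions[OF assms]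
      by (simp only:) (intro has_sum_cmult_right has_sum_of_real)
  qed (use q_pos in simp)
  also have "(\<Sum>n\<in>{0..<int q}. cnj (chi n) * of_real (1 + 2 * R n)) =
      cnj (\<Sum>n\<in>{0..<int q}. chi n) + 2 * (\<Sum>n\<in>{0..<int q}. cnj (chi n) * of_real (R n))"
    by (simp add: sum.distrib sum_distrib_left ring_distribs mult_ac)
  also have "\<dots> = 2 * theta_fourier w"
    by (simp add: theta_fourier_def R_def sum_chi_eq_0[OF nonprincipal])
  finally show ?thesis .
qed

lemma has_sum_dual_theta_fourier:
  assumes "w > 0"
  shows "((\<lambda>n. conj_character chi (int n) * of_real (dual_kernel n w)) has_sum
    (of_real (2 / (real q * w)) * theta_fourier w)) {1..}"
proof -
  have "((\<lambda>n. cnj (chi (int n)) * of_real (2 * w / (w\<^sup>2 + (2 * pi * of_int (int n) / real q)\<^sup>2))) has_sum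
      ((2 * theta_fourier w - cnj (chi 0) *
        of_real (2 * w / (w\<^sup>2 + (2 * pi * of_int 0 / real q)\<^sup>2))) / 2)) {1..}"
    by (rule has_sum_int_even[OF has_sum_int_theta_fourier[OF assms]]) (simp add: chi_minus)
  then have "((\<lambda>n. of_real (2 / (real q * w)) *
        (cnj (chi (int n)) * of_real (2 * w / (w\<^sup>2 + (2 * pi * real n / real q)\<^sup>2)))) has_sum
      (of_real (2 / (real q * w)) * theta_fourier w)) {1..}"
    by (intro has_sum_cmult_right) (simp add: chi_0)
  also have "(\<lambda>n. of_real (2 / (real q * w)) *
        (cnj (chi (int n)) * of_real (2 * w / (w\<^sup>2 + (2 * pi * real n / real q)\<^sup>2)))) =
      (\<lambda>n. conj_character chi (int n) * of_real (dual_kernel n w))"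
  proof
    fix n
    have "dual_kernel n w = 2 / (real q * w) * (2 * w / (w\<^sup>2 + (2 * pi * real n / real q)\<^sup>2))"
      using assms by (simp add: dual_kernel_def)
    then show "of_real (2 / (real q * w)) *
        (cnj (chi (int n)) * of_real (2 * w / (w\<^sup>2 + (2 * pi * real n / real q)\<^sup>2))) =
      conj_character chi (int n) * of_real (dual_kernel n w)"
      by (simp only: conj_character_def of_real_mult mult.left_commute)
  qed
  finally show ?thesis .
qed

lemma has_sum_theta:
  assumes "w > 0"
  shows "((\<lambda>d. chi (int d) * of_real (exp (- w * real d))) has_sum theta w) {1..}"
  unfolding theta_def using has_sum_theta_fourier[OF assms]
  by (intro has_sum_infsum has_sum_imp_summable)

lemma has_sum_theta_dual:
  assumes "w > 0"
  shows "((\<lambda>n. conj_character chi (int n) * of_real (dual_kernel n w)) has_sum theta_dual w) {1..}"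
  unfolding theta_dual_def using has_sum_dual_theta_fourier[OF assms]
  by (intro has_sum_infsum has_sum_imp_summable)

lemma theta_functional_equation:
  assumes "w > 0"
  shows "theta w = gauss_sum q chi / 2 * of_real w * theta_dual w"
  using infsumI[OF has_sum_theta_fourier[OF assms]] infsumI[OF has_sum_dual_theta_fourier[OF assms]]
    q_pos assms
  by (simp add: theta_def theta_dual_def)

end

subsection \<open>The logarithmic kernel\<close>

lemma ln_over_square_minus_one_le:
  fixes x :: real
  assumes "x > 0" "x \<noteq> 1"
  shows "ln x / (x\<^sup>2 - 1) \<le> 2 * x powr - (3 / 2)"
proof -
  define s where "s = sqrt x"
  have s: "s > 0" "s \<noteq> 1" "x = s\<^sup>2" using assms by (simp_all add: s_def)
  define P where "P = (s + 1) * (s\<^sup>2 + 1)"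
  have "P > 0" using s by (simp add: P_def add_pos_nonneg)
  have factor: "x\<^sup>2 - 1 = (s - 1) * P"
    by (simp add: P_def s(3) algebra_simps power2_eq_square)
  have "ln s / (s - 1) \<le> max 1 (1 / s)"
  proof (cases "s > 1")
    case True
    then have "ln s / (s - 1) \<le> 1" using ln_le_minus_one[of s] by simp
    then show ?thesis by simp
  next
    case False
    have "ln (1 / s) \<le> 1 / s - 1" using s by (intro ln_le_minus_one) simp
    then have "ln s / (s - 1) \<le> 1 / s"
      using s False by (simp add: ln_div field_simps)
    then show ?thesis by simp
  qed
  also have "\<dots> \<le> P / s ^ 3"
    using s by (simp add: P_def field_simps power2_eq_square power3_eq_cube)
  finally have "ln s / (s - 1) / P \<le> P / s ^ 3 / P"
    using \<open>P > 0\<close> by (intro divide_right_mono) auto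
  also have "P / s ^ 3 / P = 1 / s ^ 3" using \<open>P > 0\<close> by simp
  finally have "2 * (ln s / (s - 1) / P) \<le> 2 * (1 / s ^ 3)" by simp
  also have "1 / s ^ 3 = s powr (- 3)" using s by (simp add: powr_neg_numeral)
  also have "\<dots> = x powr - (3 / 2)"
    using assms by (simp add: s_def powr_powr flip: powr_half_sqrt)
  also have "2 * (ln s / (s - 1) / P) = ln x / (x\<^sup>2 - 1)"
    unfolding factor using s by (simp add: ln_realpow)
  finally show ?thesis .
qed

definition log_kernel :: "real \<Rightarrow> nat \<Rightarrow> real" where
  "log_kernel rho n = ln (real n / rho) / ((real n)\<^sup>2 - rho\<^sup>2)"

lemma log_kernel_le:
  assumes "rho > 0" "n \<ge> 1" "rho \<noteq> real n"
  shows "log_kernel rho n \<le> 2 / rho\<^sup>2 * rho powr (3 / 2) * real n powr - (3 / 2)"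
proof -
  define x where "x = real n / rho"
  have "x > 0" "x \<noteq> 1" using assms by (auto simp: x_def)
  have "log_kernel rho n = 1 / rho\<^sup>2 * (ln x / (x\<^sup>2 - 1))"
    using assms by (simp add: log_kernel_def x_def power_divide right_diff_distrib)
  also have "\<dots> \<le> 1 / rho\<^sup>2 * (2 * x powr - (3 / 2))"
    using \<open>x > 0\<close> \<open>x \<noteq> 1\<close> by (intro mult_left_mono ln_over_square_minus_one_le) auto
  also have "x powr - (3 / 2) = rho powr (3 / 2) * real n powr - (3 / 2)"
    using assms by (simp add: x_def powr_divide powr_minus_divide)
  finally show ?thesis by simp
qed

subsection \<open>The summation formula\<close>

context even_primitive_dirichlet_char
begin

lemma half_line_integral_theta: "has_bochner_integral half_line theta (dirichlet_L_one chi)"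
proof -
  have "has_bochner_integral half_line theta (\<Sum>n. (1 / real (Suc n)) *\<^sub>R chi (int (Suc n)))"
  proof (rule has_bochner_integral_sums_decseq[OF norm_sum_chi_le[OF nonprincipal]])
    show "has_bochner_integral half_line (\<lambda>w. exp (- real (Suc n) * w)) (1 / real (Suc n))" for n
      by (rule half_line_integral_exp) simp
    fix w assume "w \<in> space half_line"
    then have w: "w > 0" by (simp add: space_half_line)
    then show "decseq (\<lambda>n. exp (- real (Suc n) * w))" by (simp add: decseq_def)
    show "(\<lambda>n. exp (- real (Suc n) * w) *\<^sub>R chi (int (Suc n))) sums theta w"
      using has_sum_atLeast1_imp_sums[OF has_sum_theta[OF w]]
      by (simp add: scaleR_conv_of_real mult.commute del: of_nat_Suc)
  qed simp
  then show ?thesis by (simp add: dirichlet_L_one_def scaleR_conv_of_real del: of_nat_Suc)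
qed

lemma half_line_integral_theta_dual:
  "has_bochner_integral half_line theta_dual (dirichlet_L_one (conj_character chi))"
proof -
  have "has_bochner_integral half_line theta_dual
      (\<Sum>n. (1 / real (Suc n)) *\<^sub>R conj_character chi (int (Suc n)))"
  proof (rule has_bochner_integral_sums_decseq[OF conj.norm_sum_chi_le[OF conj_nonprincipal]])
    fix n
    have "has_bochner_integral half_line
        (\<lambda>w. 4 / real q * (1 / (w\<^sup>2 + (2 * pi * real (Suc n) / real q)\<^sup>2)))
        (4 / real q * (pi / (2 * (2 * pi * real (Suc n) / real q))))"
      using q_pos by (intro has_bochner_integral_mult_right half_line_integral_inverse_square_plus) simp
    also have "4 / real q * (pi / (2 * (2 * pi * real (Suc n) / real q))) = 1 / real (Suc n)"
      using q_pos by (simp del: of_nat_Suc)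
    finally show "has_bochner_integral half_line (dual_kernel (Suc n)) (1 / real (Suc n))"
      by (simp add: dual_kernel_def[abs_def])
  next
    fix w assume "w \<in> space half_line"
    then have w: "w > 0" by (simp add: space_half_line)
    show "decseq (\<lambda>n. dual_kernel (Suc n) w)"
      unfolding decseq_def dual_kernel_def using w q_pos
      by (intro allI impI divide_left_mono mult_left_mono add_left_mono power_mono divide_right_mono
          mult_pos_pos add_pos_nonneg) auto
    show "(\<lambda>n. dual_kernel (Suc n) w *\<^sub>R conj_character chi (int (Suc n))) sums theta_dual w"
      using has_sum_atLeast1_imp_sums[OF has_sum_theta_dual[OF w]]
      by (simp add: scaleR_conv_of_real mult.commute del: of_nat_Suc)
  qed (simp add: dual_kernel_def)
  then show ?thesis by (simp add: dirichlet_L_one_def scaleR_conv_of_real del: of_nat_Suc)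
qed

lemma has_sum_bessel_K0_half_line_integral:
  assumes "r > 0"
  shows "((\<lambda>n. d_chi chi n * of_real (2 * bessel_K0 (2 * sqrt (r * real n)))) has_sum
    (\<integral>w. theta w * of_real (1 / (exp (r / w) - 1) / w) \<partial>half_line)) {1..}"
  unfolding d_chi_def
proof (rule has_sum_integral_divisor_sum(2)[where p = 2 and C = "12 / r\<^sup>2"])
  fix m n :: nat assume mn: "m \<ge> 1" "n \<ge> 1"
  have product: "exp (- real m * w - r * real n / w) / w =
      exp (- w * real m) * (exp (- (real n * (r / w))) / w)" for w
    by (simp add: mult_ac flip: exp_add)
  show "has_bochner_integral half_line (\<lambda>w. exp (- w * real m) * (exp (- (real n * (r / w))) / w))
      (2 * bessel_K0 (2 * sqrt (r * real (m * n))))"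
    using half_line_integral_bessel_K0[of "real m" "r * real n"] mn \<open>r > 0\<close>
    unfolding product by (simp add: mult.left_commute)
next
  fix n :: nat assume n: "n \<ge> 1"
  define y where "y = sqrt (r * real n)"
  have "y > 0" using n \<open>r > 0\<close> by (simp add: y_def)
  then have "2 * bessel_K0 (2 * y) \<le> 2 * (fact 3 * (2 / (2 * y)) ^ Suc 3)"
    by (intro mult_left_mono bessel_K0_le) simp_all
  also have "\<dots> = 12 / (y\<^sup>2)\<^sup>2"
    by (simp add: power_divide fact_numeral flip: power_mult)
  also have "\<dots> = 12 / r\<^sup>2 * real n powr - 2"
    using n \<open>r > 0\<close> by (simp add: y_def power_mult_distrib powr_neg_numeral)
  finally show "2 * bessel_K0 (2 * sqrt (r * real n)) \<le> 12 / r\<^sup>2 * real n powr - 2"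
    by (simp add: y_def)
next
  fix w assume "w \<in> space half_line"
  then have w: "w > 0" by (simp add: space_half_line)
  then show "((\<lambda>d. chi (int d) * of_real (exp (- w * real d))) has_sum theta w) {1..}"
    by (rule has_sum_theta)
  show "((\<lambda>n. exp (- (real n * (r / w))) / w) has_sum (1 / (exp (r / w) - 1) / w)) {1..}"
    using w \<open>r > 0\<close> by (intro has_sum_divide_const has_sum_exp_geometric) simp
  show "exp (- (real n * (r / w))) / w \<ge> 0" for n using w by simp
qed (simp_all add: norm_chi_le_1)

context
  fixes r rho :: real
  assumes r_pos: "r > 0" and rho: "rho = r * real q / (4 * pi\<^sup>2)"
    and rho_neq: "\<And>n. n \<ge> 1 \<Longrightarrow> rho \<noteq> real n"
begin

lemma rho_pos: "rho > 0"
  using r_pos q_pos by (simp add: rho)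

lemma half_line_integral_dual_kernel_mult:
  assumes "m \<ge> 1" "n \<ge> 1"
  shows "has_bochner_integral half_line
    (\<lambda>w. dual_kernel m w * (2 * (r / w) / ((r / w)\<^sup>2 + (2 * pi * real n)\<^sup>2)))
    (2 * rho / pi\<^sup>2 * log_kernel rho (m * n))"
proof -
  define a where "a = 2 * pi * real m / real q"
  define b where "b = r / (2 * pi * real n)"
  define N where "N = real (m * n)"
  have pos: "a > 0" "b > 0" using assms q_pos r_pos by (simp_all add: a_def b_def)
  have ratio: "a = b * (N / rho)"
    using assms q_pos r_pos by (simp add: a_def b_def N_def rho power2_eq_square)
  have "N \<noteq> rho" using rho_neq[of "m * n"] assms by (auto simp: N_def)
  then have "a \<noteq> b" using ratio pos rho_pos by (simp del: times_divide_eq_right)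
  then have "has_bochner_integral half_line
      (\<lambda>w. 8 * b\<^sup>2 / (r * real q) * (w / ((w\<^sup>2 + a\<^sup>2) * (w\<^sup>2 + b\<^sup>2))))
      (8 * b\<^sup>2 / (r * real q) * (ln (a / b) / (a\<^sup>2 - b\<^sup>2)))"
    using pos by (intro has_bochner_integral_mult_right half_line_integral_square_plus_product)
  also have "8 * b\<^sup>2 / (r * real q) * (ln (a / b) / (a\<^sup>2 - b\<^sup>2)) =
      2 * rho / pi\<^sup>2 * log_kernel rho (m * n)"
  proof -
    have "a\<^sup>2 - b\<^sup>2 = b\<^sup>2 / rho\<^sup>2 * (N\<^sup>2 - rho\<^sup>2)"
      using rho_pos by (simp add: ratio power_mult_distrib power_divide right_diff_distrib)
    moreover have "a / b = N / rho" using pos by (simp add: ratio)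
    moreover have "r * real q = 4 * pi\<^sup>2 * rho" by (simp add: rho)
    moreover have "log_kernel rho (m * n) = ln (N / rho) / (N\<^sup>2 - rho\<^sup>2)"
      by (simp only: log_kernel_def N_def)
    ultimately show ?thesis using pos rho_pos by (simp add: power2_eq_square mult_ac)
  qed
  finally show ?thesis
  proof (rule has_bochner_integral_cong[THEN iffD1, rotated 3])
    fix w assume "w \<in> space half_line"
    then have w: "w > 0" by (simp add: space_half_line)
    have "2 * (r / w) / ((r / w)\<^sup>2 + (2 * pi * real n)\<^sup>2) = 2 * b\<^sup>2 / r * w / (w\<^sup>2 + b\<^sup>2)"
      unfolding b_def using w r_pos assms by (intro partial_fraction_term_inverse) simp_all
    moreover have "dual_kernel m w = 4 / real q / (w\<^sup>2 + a\<^sup>2)"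
      by (simp add: dual_kernel_def a_def)
    ultimately show "8 * b\<^sup>2 / (r * real q) * (w / ((w\<^sup>2 + a\<^sup>2) * (w\<^sup>2 + b\<^sup>2))) =
        dual_kernel m w * (2 * (r / w) / ((r / w)\<^sup>2 + (2 * pi * real n)\<^sup>2))"
      by (simp add: mult_ac)
  qed simp_all
qed

lemma has_sum_log_kernel_half_line_integral:
  "integrable half_line (\<lambda>w. theta_dual w * of_real (exp_remainder (r / w)))"
  "((\<lambda>n. d_chi (conj_character chi) n *
        of_real (2 * rho / pi\<^sup>2 * log_kernel rho n)) has_sum
      (\<integral>w. theta_dual w * of_real (exp_remainder (r / w)) \<partial>half_line)) {1..}"
proof -
  have decay: "2 * rho / pi\<^sup>2 * log_kernel rho n \<le>
      2 * rho / pi\<^sup>2 * (2 / rho\<^sup>2 * rho powr (3 / 2)) * real n powr - (3 / 2)" if "n \<ge> 1" for n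
    unfolding mult.assoc[of "2 * rho / pi\<^sup>2"]
    using log_kernel_le[OF rho_pos that rho_neq[OF that]] rho_pos
    by (intro mult_left_mono) simp_all
  have pos: "w > 0" if "w \<in> space half_line" for w
    using that by (simp add: space_half_line)
  have partial_fractions: "((\<lambda>k. 2 * (r / w) / ((r / w)\<^sup>2 + (2 * pi * real k)\<^sup>2)) has_sum
      exp_remainder (r / w)) {1..}" if "w \<in> space half_line" for w
    by (rule has_sum_exp_remainder) (use pos[OF that] r_pos in simp)
  have nonneg: "dual_kernel n w \<ge> 0" "2 * (r / w) / ((r / w)\<^sup>2 + (2 * pi * real n)\<^sup>2) \<ge> 0"
    if "w \<in> space half_line" for n w
    using pos[OF that] r_pos by (simp_all add: dual_kernel_def)
  note interchange = has_sum_integral_divisor_sum[OF conj.norm_chi_le_1 nonneg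
      half_line_integral_dual_kernel_mult decay _ has_sum_theta_dual[OF pos] partial_fractions]
  show "integrable half_line (\<lambda>w. theta_dual w * of_real (exp_remainder (r / w)))"
    by (rule interchange) simp_all
  show "((\<lambda>n. d_chi (conj_character chi) n *
        of_real (2 * rho / pi\<^sup>2 * log_kernel rho n)) has_sum
      (\<integral>w. theta_dual w * of_real (exp_remainder (r / w)) \<partial>half_line)) {1..}"
    unfolding d_chi_def by (rule interchange) simp_all
qed

lemma half_line_integral_theta_dual_remainder:
  "has_bochner_integral half_line (\<lambda>w. theta_dual w * of_real (exp_remainder (r / w)))
    (of_real (2 * rho / pi\<^sup>2) * (\<Sum>n. d_chi (conj_character chi) (Suc n) *
      of_real (log_kernel rho (Suc n))))"
proof -
  define D where "D n = d_chi (conj_character chi) n * of_real (log_kernel rho n)" for n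
  define J where "J = (\<integral>w. theta_dual w * of_real (exp_remainder (r / w)) \<partial>half_line)"
  have "((\<lambda>n. of_real (2 * rho / pi\<^sup>2) * D n) has_sum J) {1..}"
    using has_sum_log_kernel_half_line_integral(2)
    by (simp only: D_def J_def of_real_mult mult.left_commute)
  from has_sum_cmult_right[OF this, of "of_real (pi\<^sup>2 / (2 * rho))"]
  have "(D has_sum (of_real (pi\<^sup>2 / (2 * rho)) * J)) {1..}"
    using rho_pos by simp
  then have "(\<Sum>n. D (Suc n)) = of_real (pi\<^sup>2 / (2 * rho)) * J"
    by (intro sums_unique[symmetric] has_sum_atLeast1_imp_sums)
  then have "J = of_real (2 * rho / pi\<^sup>2) * (\<Sum>n. D (Suc n))"
    using rho_pos by simp
  then show ?thesis
    using has_sum_log_kernel_half_line_integral(1) by (simp add: has_bochner_integral_iff J_def D_def)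
qed

theorem has_sum_d_chi_bessel_K0:
  "((\<lambda>n. d_chi chi n * of_real (bessel_K0 (2 * sqrt (r * real n)))) has_sum
    (of_real (1 / (2 * r)) * dirichlet_L_one chi
      - gauss_sum q chi / 8 * dirichlet_L_one (conj_character chi)
      + of_real (rho / (2 * pi\<^sup>2)) * gauss_sum q chi * (\<Sum>n. d_chi (conj_character chi) (Suc n) *
          of_real (log_kernel rho (Suc n))))) {1..}"
    (is "(_ has_sum (_ - _ + _ * ?S)) _")
proof -
  define R where "R w = theta_dual w * of_real (exp_remainder (r / w))" for w
  let ?V = "dirichlet_L_one chi / of_real r - gauss_sum q chi / 4 * dirichlet_L_one (conj_character chi)
    + gauss_sum q chi / 2 * (of_real (2 * rho / pi\<^sup>2) * ?S)"
  have split: "theta w * of_real (1 / (exp (r / w) - 1) / w) =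
      theta w / of_real r - gauss_sum q chi / 4 * theta_dual w + gauss_sum q chi / 2 * R w"
    if "w > 0" for w
  proof -
    have "theta w * of_real (1 / (exp (r / w) - 1) / w) =
        theta w / of_real r - theta w / of_real w / 2
        + theta w / of_real w * of_real (exp_remainder (r / w))"
      using that r_pos by (simp add: exp_remainder_def field_simps)
    then show ?thesis
      using that by (simp add: theta_functional_equation R_def)
  qed
  have "(\<integral>w. theta w * of_real (1 / (exp (r / w) - 1) / w) \<partial>half_line) =
      (\<integral>w. theta w / of_real r - gauss_sum q chi / 4 * theta_dual w
        + gauss_sum q chi / 2 * R w \<partial>half_line)"
    by (rule Bochner_Integration.integral_cong[OF refl split]) (simp add: space_half_line)
  also have "\<dots> = ?V"
    unfolding R_def
    by (intro has_bochner_integral_integral_eq has_bochner_integral_add has_bochner_integral_diff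
        has_bochner_integral_mult_right has_bochner_integral_divide
        half_line_integral_theta half_line_integral_theta_dual half_line_integral_theta_dual_remainder)
  finally have "((\<lambda>n. d_chi chi n * of_real (2 * bessel_K0 (2 * sqrt (r * real n)))) has_sum ?V) {1..}"
    using has_sum_bessel_K0_half_line_integral[OF r_pos] by (simp only:)
  from has_sum_cmult_right[OF this, of "1 / 2"]
  show ?thesis by (simp add: algebra_simps)
qed

end
end

theorem theorem2p9:
  fixes q :: nat and chi :: "int \<Rightarrow> complex" and a x :: real
  assumes "primitive_character q chi"
    and "\<not> principal_character q chi"
    and "even_character chi"
    and "a > 0" and "x > 0"
    and "\<forall>k::nat. k > 0 \<longrightarrow> a\<^sup>2 * real q * x / (16 * pi\<^sup>2) \<noteq> real k"
  shows "(\<Sum>n. d_chi chi (Suc n) * complex_of_real (bessel_K0 (a * sqrt (real (Suc n) * x))))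
       = complex_of_real (2 / (a\<^sup>2 * x)) * dirichlet_L_one chi
         - gauss_sum q chi / 8 * dirichlet_L_one (conj_character chi)
         + complex_of_real (a\<^sup>2 * real q * x / (32 * pi ^ 4)) * gauss_sum q chi *
           (\<Sum>n. d_chi (conj_character chi) (Suc n) *
              complex_of_real (ln (16 * pi\<^sup>2 * real (Suc n) / (a\<^sup>2 * real q * x))
                / ((real (Suc n))\<^sup>2 - (a\<^sup>2 * real q * x / (16 * pi\<^sup>2))\<^sup>2)))"
proof -
  interpret even_primitive_dirichlet_char q chi
    using assms by unfold_locales (auto simp: primitive_character_def)
  define r where "r = a\<^sup>2 * x / 4"
  define rho where "rho = a\<^sup>2 * real q * x / (16 * pi\<^sup>2)"
  have r: "r > 0" using assms by (simp add: r_def)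
  have rho: "rho = r * real q / (4 * pi\<^sup>2)" by (simp add: r_def rho_def)
  have rho_neq: "rho \<noteq> real n" if "n \<ge> 1" for n using assms(6) that by (simp add: rho_def)
  have argument: "a * sqrt (real n * x) = 2 * sqrt (r * real n)" for n
    using assms by (simp add: r_def real_sqrt_mult real_sqrt_divide)
  have ln_argument: "16 * pi\<^sup>2 * real n / (a\<^sup>2 * real q * x) = real n / rho" for n
    by (simp add: rho_def)
  have "2 / (a\<^sup>2 * x) = 1 / (2 * r)" "a\<^sup>2 * real q * x / (32 * pi ^ 4) = rho / (2 * pi\<^sup>2)"
    by (simp_all add: r_def rho_def power2_eq_square power4_eq_xxxx)
  then show ?thesis
    unfolding argument ln_argument rho_def[symmetric]
    using has_sum_atLeast1_imp_sums[OF has_sum_d_chi_bessel_K0[OF r rho rho_neq], THEN sums_unique]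
    by (simp add: log_kernel_def)
qed

end
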